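(* Let $\rho>0$ and let $G$ be a locally integrable completely monotonic relaxation modulus with $G_\infty>0$. Let $Q,\kappa,\beta$ be the associated functions and let $x>0$. Let $M(\cdot,x)$ be the causal tempered distribution whose Fourier transform is $\hat M(\omega,x)=e^{-\beta(-i\omega)x}$, and let $u^{(1)}(\cdot,x)$ be the one-dimensional viscoelastic Green's function, i.e. the causal tempered distribution whose Fourier transform is $$\hat u^{(1)}(\omega,x)=\frac{\rho}{2\,Q(-i\omega)\,\kappa(-i\omega)}\,e^{-\kappa(-i\omega)x}$$ for $\operatorname{Im}\omega>0$. Then $M(\cdot,x)$ and $u^{(1)}(\cdot,x)$ are minimum phase. Moreover, if $s$ is a minimum phase tempered distribution, then the convolution $s\ast u^{(1)}(\cdot,x)$ in time is minimum phase.
   Context: A distribution on $\mathbb{R}$ is causal if it is supported in $[0,\infty)$. The Fourier transform of a causal tempered distribution $T$ is $\hat T(\omega)=\langle T,e^{i\omega t}\rangle$, holomorphic in the upper half-plane $\mathbb{C}^+=\{\operatorname{Im}\omega>0\}$. A causal tempered distribution $T$ is minimum phase if $\hat T$ and $1/\hat T$ are both analytic in $\mathbb{C}^+$. A function on $(0,\infty)$ is completely monotonic (CM) if it is infinitely differentiable and $(-1)^n f^{(n)}\ge0$ for all $n\ge0$; it is locally integrable if integrable over $[0,1]$. For such $G$, $G_\infty:=\lim_{t\to\infty}G(t)$, $Q(p):=p\tilde G(p)$ where $\tilde G(p)=\int_0^\infty G(t)e^{-pt}dt$ (analytically continued to $\mathbb{C}\setminus(-\infty,0]$), and $\kappa(p):=\rho^{1/2}p/Q(p)^{1/2}$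 with the branch positive for $p>0$. When $G_\infty>0$ there are a unique $B\ge0$ and a unique positive Radon measure $\nu$ on $(0,\infty)$ with $\int_{(0,\infty)}\nu(dr)/(1+r)<\infty$ such that $\kappa(p)=Bp+\beta(p)$, $\beta(p)=p\int_{(0,\infty)}\nu(dr)/(p+r)$. The wavefront speed is $c_\infty=1/B\in(0,\infty]$. *)

theory Defs
  imports "HOL-Complex_Analysis.Complex_Analysis"
begin

section \<open>Tempered distributions on the real line\<close>

type_synonym functional = "(real \<Rightarrow> complex) \<Rightarrow> complex"

definition vderiv :: "(real \<Rightarrow> complex) \<Rightarrow> real \<Rightarrow> complex" where
  "vderiv f = (\<lambda>t. vector_derivative f (at t))"

definition smooth :: "(real \<Rightarrow> complex) \<Rightarrow> bool" where
  "smooth f \<longleftrightarrow> (\<forall>n t. (vderiv ^^ n) f differentiable (at t))"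

definition test_function :: "(real \<Rightarrow> complex) \<Rightarrow> bool" where
  "test_function f \<longleftrightarrow> smooth f \<and> compact (closure {t. f t \<noteq> 0})"

definition schwartz :: "(real \<Rightarrow> complex) \<Rightarrow> bool" where
  "schwartz f \<longleftrightarrow> smooth f \<and>
     (\<forall>k n. bounded (range (\<lambda>t. \<bar>t\<bar> ^ k * norm ((vderiv ^^ n) f t))))"

definition schwartz_seminorm :: "nat \<Rightarrow> nat \<Rightarrow> (real \<Rightarrow> complex) \<Rightarrow> real" where
  "schwartz_seminorm k n f = (SUP t. \<bar>t\<bar> ^ k * norm ((vderiv ^^ n) f t))"

text \<open>Functionals are total, but only their values on Schwartz functions matter.
  The estimate is continuity for the topology generated by the Schwartz seminorms.\<close>

definition tempered_distribution :: "functional \<Rightarrow> bool" where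
  "tempered_distribution T \<longleftrightarrow>
     (\<forall>f g. schwartz f \<longrightarrow> schwartz g \<longrightarrow> T (\<lambda>t. f t + g t) = T f + T g) \<and>
     (\<forall>c f. schwartz f \<longrightarrow> T (\<lambda>t. c * f t) = c * T f) \<and>
     (\<exists>C N. \<forall>f. schwartz f \<longrightarrow>
        norm (T f) \<le> C * (\<Sum>k\<le>N. \<Sum>n\<le>N. schwartz_seminorm k n f))"

definition supported_in :: "functional \<Rightarrow> real set \<Rightarrow> bool" where
  "supported_in T F \<longleftrightarrow>
     (\<forall>f. test_function f \<longrightarrow> closure {t. f t \<noteq> 0} \<inter> F = {} \<longrightarrow> T f = 0)"

definition causal :: "functional \<Rightarrow> bool" where
  "causal T \<longleftrightarrow> supported_in T {0..}"

text \<open>The pairing of a causal tempered distribution with a function f that need not be a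
  Schwartz function itself, but agrees with one on a neighbourhood of the half-line
  of nonnegative reals. The value does not depend on the chosen Schwartz function, since T
  vanishes on Schwartz functions that are zero near that half-line.\<close>

definition causal_pairing :: "functional \<Rightarrow> (real \<Rightarrow> complex) \<Rightarrow> complex" where
  "causal_pairing T f = T (SOME g. schwartz g \<and> (\<exists>\<epsilon>>0. \<forall>t>-\<epsilon>. g t = f t))"

definition upper_half_plane :: "complex set" where
  "upper_half_plane = {\<omega>. Im \<omega> > 0}"

definition fourier :: "functional \<Rightarrow> complex \<Rightarrow> complex" where
  "fourier T \<omega> = causal_pairing T (\<lambda>t. exp (\<i> * \<omega> * of_real t))"

text \<open>For causal S and T and a Schwartz function f, the function
  t \<open>\<mapsto>\<close> T (f (t + \<open>\<cdot>\<close>)) is smooth and rapidly decreasing at \<open>+\<infinity>\<close>, though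
  in general not at \<open>-\<infinity>\<close>; hence the causal pairing on the outside.\<close>

definition convolution :: "functional \<Rightarrow> functional \<Rightarrow> functional" where
  "convolution S T = (\<lambda>f. causal_pairing S (\<lambda>t. T (\<lambda>\<tau>. f (t + \<tau>))))"

text \<open>Nonvanishing is implicit in speaking of the reciprocal; it has to be explicit here
  because \<open>1 / 0 = 0\<close> in HOL.\<close>

definition minimum_phase :: "functional \<Rightarrow> bool" where
  "minimum_phase T \<longleftrightarrow> tempered_distribution T \<and> causal T \<and>
     fourier T analytic_on upper_half_plane \<and>
     (\<forall>\<omega>\<in>upper_half_plane. fourier T \<omega> \<noteq> 0) \<and>
     (\<lambda>\<omega>. 1 / fourier T \<omega>) analytic_on upper_half_plane"

section \<open>Relaxation moduli\<close>

definition completely_monotonic :: "(real \<Rightarrow> real) \<Rightarrow> bool" where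
  "completely_monotonic f \<longleftrightarrow>
     (\<forall>n. \<forall>t>0. (deriv ^^ n) f differentiable (at t) \<and> (-1) ^ n * (deriv ^^ n) f t \<ge> 0)"

definition locally_integrable :: "(real \<Rightarrow> real) \<Rightarrow> bool" where
  "locally_integrable f \<longleftrightarrow> set_integrable lborel {0<..1} f"

definition G_infinity :: "(real \<Rightarrow> real) \<Rightarrow> real" where
  "G_infinity G = Lim at_top G"

definition cut_plane :: "complex set" where
  "cut_plane = - {p. Im p = 0 \<and> Re p \<le> 0}"

definition analytic_continuation ::
    "complex set \<Rightarrow> complex set \<Rightarrow> (complex \<Rightarrow> complex) \<Rightarrow> complex \<Rightarrow> complex" where
  "analytic_continuation U V f p =
     (if p \<in> U then f p else (SOME g. g analytic_on V \<and> (\<forall>q\<in>U. g q = f q)) p)"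

definition laplace :: "(real \<Rightarrow> real) \<Rightarrow> complex \<Rightarrow> complex" where
  "laplace G = analytic_continuation {p. Re p > 0} cut_plane
     (\<lambda>p. LBINT t:{0<..}. of_real (G t) * exp (- p * of_real t))"

definition Q_of :: "(real \<Rightarrow> real) \<Rightarrow> complex \<Rightarrow> complex" where
  "Q_of G p = p * laplace G p"

text \<open>For a locally integrable completely monotonic G that is not identically zero,
  \<open>Q_of G\<close> is a complete Bernstein function and maps the cut plane into itself. So the
  principal square root is the analytic branch that is positive for \<open>p > 0\<close>.\<close>

definition kappa :: "real \<Rightarrow> (real \<Rightarrow> real) \<Rightarrow> complex \<Rightarrow> complex" where
  "kappa \<rho> G p = of_real (sqrt \<rho>) * p / csqrt (Q_of G p)"

definition radon_measure_pos :: "real measure \<Rightarrow> bool" where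
  "radon_measure_pos \<nu> \<longleftrightarrow> sets \<nu> = sets (restrict_space borel {0<..}) \<and>
     (\<forall>K. compact K \<and> K \<subseteq> {0<..} \<longrightarrow> emeasure \<nu> K < \<infinity>)"

definition beta :: "real measure \<Rightarrow> complex \<Rightarrow> complex" where
  "beta \<nu> p = p * (\<integral>r. 1 / (p + of_real r) \<partial>\<nu>)"

text \<open>The pair (B, \<open>\<nu>\<close>) is uniquely determined by the values of \<open>kappa\<close> at positive p, and the
  identity then extends to the whole cut plane by analytic continuation.\<close>

definition kappa_representation ::
    "real \<Rightarrow> (real \<Rightarrow> real) \<Rightarrow> real \<Rightarrow> real measure \<Rightarrow> bool" where
  "kappa_representation \<rho> G B \<nu> \<longleftrightarrow>
     B \<ge> 0 \<and> radon_measure_pos \<nu> \<and> (\<integral>\<^sup>+r. ennreal (1 / (1 + r)) \<partial>\<nu>) < \<infinity> \<and>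
     (\<forall>p::real. p > 0 \<longrightarrow>
        kappa \<rho> G (of_real p) = of_real B * of_real p + beta \<nu> (of_real p))"

end

theory Submission imports Defs begin

text \<open>Convolution: a causal tempered distribution \<open>T\<close> depends on a test function \<open>f\<close> only through
  its germ on the nonnegative half-line. So \<open>t \<mapsto> T (f (t + \<cdot>))\<close> is bounded, with all its
  derivatives and for \<open>t \<ge> -2\<close>, by Schwartz seminorms of \<open>f\<close> times any negative power of
  \<open>1 + \<bar>t\<bar>\<close>; cut off on the left it is a Schwartz function depending continuously on \<open>f\<close>.
  Hence \<open>S * T\<close> is tempered and causal, and testing with \<open>exp (\<i>\<omega>t)\<close>, cut off on the left,
  shows that its Fourier transform is the product of those of \<open>S\<close> and \<open>T\<close>.

  Green's function: for \<open>Re p > 0\<close>, partial integration against \<open>1 - exp (-pt)\<close>, whose real part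
  is nonnegative, gives \<open>Re (Q p) \<ge> G\<^sub>\<infinity> > 0\<close> from \<open>G \<ge> 0\<close> and \<open>G' \<le> 0\<close> alone. So \<open>Q\<close> avoids the
  cut of the square root and has no zero, and \<open>\<kappa>\<close> is holomorphic and nonvanishing on the right
  half-plane.\<close>

section \<open>Calculus of smooth functions\<close>

text \<open>\<open>causal\<close> tests a functional only on compactly supported functions, while
  \<open>causal_pairing\<close> picks an arbitrary Schwartz representative. Evaluating
  \<open>fourier\<close> or \<open>convolution\<close> on a concrete function therefore rests on
  \<open>causal_zero\<close>, where Schwartz functions are approximated by compactly supported ones
  in finitely many seminorms. In the partial integration, \<open>G\<close> may be unbounded at 0.
  The boundary term still vanishes there: 1 - exp(-pt) is of first order at 0, and t G(t) tends to 0
  along a sequence by local integrability and monotonicity. The substitution p = -i omega carries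
  the upper half-plane onto the right half-plane, where \<open>laplace\<close> is the integral
  itself and can be estimated directly. For \<open>M\<close>, the transform is an exponential, hence
  without zeros, and \<open>beta\<close> is holomorphic as an integral depending on a
  parameter.\<close>

lemma smooth_coinduct:
  assumes "f \<in> X" and "\<And>g. g \<in> X \<Longrightarrow> (\<forall>t. g differentiable (at t)) \<and> vderiv g \<in> X"
  shows "smooth f"
proof -
  \<comment> \<open>A family closed under one derivative contains all iterates. So closure
    properties of \<open>smooth\<close> follow from a single differentiation rule, without a formula
    for the n-th derivative.\<close>
  have "(vderiv ^^ n) f \<in> X" for n
    by (induction n) (use assms in auto)
  then show ?thesis using assms(2) unfolding smooth_def by blast
qed

lemma vderivI:
  assumes "\<And>t. (f has_vector_derivative f' t) (at t)"
  shows "vderiv f = f'"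
  using assms by (auto simp: vderiv_def fun_eq_iff intro!: vector_derivative_at)

lemma smooth_has_vderiv:
  assumes "smooth f"
  shows "((vderiv ^^ n) f has_vector_derivative (vderiv ^^ Suc n) f t) (at t)"
  using assms by (simp add: smooth_def vderiv_def flip: vector_derivative_works)

lemma smooth_has_vderiv':
  assumes "smooth f"
  shows "(f has_vector_derivative vderiv f t) (at t)"
  using smooth_has_vderiv[OF assms, of 0] by simp

lemma smooth_nderiv: "smooth f \<Longrightarrow> smooth ((vderiv ^^ n) f)"
  unfolding smooth_def by (metis comp_apply funpow_add)

lemma smooth_vderiv: "smooth f \<Longrightarrow> smooth (vderiv f)"
  using smooth_nderiv[of f 1] by simp

lemma smooth_from_vderiv:
  assumes "\<And>t. (f has_vector_derivative f' t) (at t)" and "smooth f'"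
  shows "smooth f"
proof (rule smooth_coinduct[where X = "{f} \<union> range (\<lambda>n. (vderiv ^^ n) f')"])
  fix g assume g: "g \<in> {f} \<union> range (\<lambda>n. (vderiv ^^ n) f')"
  have v: "vderiv f = f'" using assms(1) by (rule vderivI)
  show "(\<forall>t. g differentiable (at t)) \<and> vderiv g \<in> {f} \<union> range (\<lambda>n. (vderiv ^^ n) f')"
  proof (cases "g = f")
    case True
    have "f' = (vderiv ^^ 0) f'" by simp
    then show ?thesis using True v assms(1) by (metis UnCI differentiableI_vector rangeI)
  next
    case False
    then obtain n where n: "g = (vderiv ^^ n) f'" using g by auto
    have "vderiv g = (vderiv ^^ Suc n) f'" by (simp add: n)
    then show ?thesis using assms(2) by (auto simp: smooth_def n simp del: funpow.simps)
  qed
qed auto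

lemma nderiv_Suc: "(vderiv ^^ Suc n) f = (vderiv ^^ n) (vderiv f)"
  by (simp only: funpow_Suc_right comp_apply)

lemma vderiv_add:
  assumes "smooth f" "smooth g"
  shows "((\<lambda>t. f t + g t) has_vector_derivative vderiv f t + vderiv g t) (at t)"
  by (intro has_vector_derivative_add smooth_has_vderiv' assms)

lemma smooth_add:
  assumes "smooth f" "smooth g"
  shows "smooth (\<lambda>t. f t + g t)"
proof (rule smooth_coinduct[where X = "{\<lambda>t. f t + g t | f g. smooth f \<and> smooth g}"])
  fix h assume "h \<in> {\<lambda>t. f t + g t | f g. smooth f \<and> smooth g}"
  then obtain f g where h: "h = (\<lambda>t. f t + g t)" "smooth f" "smooth g" by auto
  have "vderiv h = (\<lambda>t. vderiv f t + vderiv g t)"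
    unfolding h(1) by (rule vderivI) (rule vderiv_add[OF h(2,3)])
  moreover have "h differentiable at t" for t
    unfolding h(1) by (rule differentiableI_vector[OF vderiv_add[OF h(2,3)]])
  ultimately show "(\<forall>t. h differentiable (at t)) \<and>
      vderiv h \<in> {\<lambda>t. f t + g t | f g. smooth f \<and> smooth g}"
    using smooth_vderiv[OF h(2)] smooth_vderiv[OF h(3)] by blast
qed (use assms in auto)

lemma nderiv_add:
  assumes "smooth f" "smooth g"
  shows "(vderiv ^^ n) (\<lambda>t. f t + g t) = (\<lambda>t. (vderiv ^^ n) f t + (vderiv ^^ n) g t)"
  using assms
proof (induction n arbitrary: f g)
  case (Suc n)
  have "vderiv (\<lambda>t. f t + g t) = (\<lambda>t. vderiv f t + vderiv g t)"
    by (rule vderivI) (rule vderiv_add[OF Suc.prems])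
  then show ?case using Suc.IH[OF smooth_vderiv smooth_vderiv, OF Suc.prems]
    by (simp only: nderiv_Suc)
qed simp

text \<open>The factor \<open>k\<close> absorbs the \<open>c\<close> that each chain rule produces,
  which keeps the family closed under derivatives. Scalar multiples, translations and the reflection
  in the bump function below are all instances.\<close>

lemma vderiv_affine:
  assumes "smooth f"
  shows "((\<lambda>t. k * f (a + c * t)) has_vector_derivative (k * of_real c) * vderiv f (a + c * t)) (at t)"
proof -
  have "((f \<circ> (\<lambda>t. a + c * t)) has_vector_derivative c *\<^sub>R vderiv f (a + c * t)) (at t)"
    by (rule vector_diff_chain_at)
      (auto intro!: derivative_eq_intros smooth_has_vderiv'[OF assms]
        simp flip: has_real_derivative_iff_has_vector_derivative)
  then have "((\<lambda>t. k * (f \<circ> (\<lambda>t. a + c * t)) t) has_vector_derivative k * (c *\<^sub>R vderiv f (a + c * t))) (at t)"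
    by (rule has_vector_derivative_mult_right)
  then show ?thesis by (simp add: scaleR_conv_of_real mult.assoc)
qed

lemma smooth_affine:
  assumes "smooth f"
  shows "smooth (\<lambda>t. k * f (a + c * t))"
proof (rule smooth_coinduct[where X = "{\<lambda>t. k * f (a + c * t) | k f. smooth f}"])
  fix h assume "h \<in> {\<lambda>t. k * f (a + c * t) | k f. smooth f}"
  then obtain k f where h: "h = (\<lambda>t. k * f (a + c * t))" "smooth f" by auto
  have "vderiv h = (\<lambda>t. (k * of_real c) * vderiv f (a + c * t))"
    unfolding h(1) by (rule vderivI) (rule vderiv_affine[OF h(2)])
  moreover have "h differentiable at t" for t
    unfolding h(1) by (rule differentiableI_vector[OF vderiv_affine[OF h(2)]])
  ultimately show "(\<forall>t. h differentiable (at t)) \<and>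
      vderiv h \<in> {\<lambda>t. k * f (a + c * t) | k f. smooth f}"
    using smooth_vderiv[OF h(2)] by blast
qed (use assms in auto)

lemma nderiv_affine:
  assumes "smooth f"
  shows "(vderiv ^^ n) (\<lambda>t. k * f (a + c * t)) = (\<lambda>t. k * of_real c ^ n * (vderiv ^^ n) f (a + c * t))"
  using assms
proof (induction n arbitrary: f k)
  case (Suc n)
  have "vderiv (\<lambda>t. k * f (a + c * t)) = (\<lambda>t. (k * of_real c) * vderiv f (a + c * t))"
    by (rule vderivI) (rule vderiv_affine[OF Suc.prems])
  then show ?case using Suc.IH[OF smooth_vderiv, OF Suc.prems]
    by (simp only: nderiv_Suc) (simp add: mult.assoc)
qed simp

lemma smooth_cmult: "smooth f \<Longrightarrow> smooth (\<lambda>t. c * f t)"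
  using smooth_affine[of f c 0 1] by simp

lemma nderiv_cmult: "smooth f \<Longrightarrow> (vderiv ^^ n) (\<lambda>t. c * f t) = (\<lambda>t. c * (vderiv ^^ n) f t)"
  using nderiv_affine[of f n c 0 1] by simp

lemma smooth_translate: "smooth f \<Longrightarrow> smooth (\<lambda>t. f (a + t))"
  using smooth_affine[of f 1 a 1] by simp

lemma nderiv_translate:
  "smooth f \<Longrightarrow> (vderiv ^^ n) (\<lambda>t. f (a + t)) = (\<lambda>t. (vderiv ^^ n) f (a + t))"
  using nderiv_affine[of f n 1 a 1] by simp

text \<open>The coinduction set for \<open>smooth_mult\<close>: by the product rule, products alone are not closed
  under derivatives, but their sums are.\<close>

inductive_set sums_of_products :: "(real \<Rightarrow> complex) set" where
  prod: "smooth f \<Longrightarrow> smooth g \<Longrightarrow> (\<lambda>t. f t * g t) \<in> sums_of_products"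
| add: "f \<in> sums_of_products \<Longrightarrow> g \<in> sums_of_products \<Longrightarrow> (\<lambda>t. f t + g t) \<in> sums_of_products"

lemma vderiv_mult:
  assumes "smooth f" "smooth g"
  shows "((\<lambda>t. f t * g t) has_vector_derivative f t * vderiv g t + vderiv f t * g t) (at t)"
  by (intro has_vector_derivative_mult smooth_has_vderiv' assms)

lemma smooth_mult:
  assumes "smooth f" "smooth g"
  shows "smooth (\<lambda>t. f t * g t)"
proof (rule smooth_coinduct[where X = sums_of_products])
  fix h assume "h \<in> sums_of_products"
  then have "\<exists>h'\<in>sums_of_products. \<forall>t. (h has_vector_derivative h' t) (at t)"
  proof induction
    case (prod f g)
    then have "(\<lambda>t. f t * vderiv g t + vderiv f t * g t) \<in> sums_of_products"
      by (intro sums_of_products.intros smooth_vderiv)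
    then show ?case using vderiv_mult[OF prod]
      by (intro bexI[of _ "\<lambda>t. f t * vderiv g t + vderiv f t * g t"]) auto
  next
    case (add f g)
    then obtain f' g' where "f' \<in> sums_of_products" "g' \<in> sums_of_products"
      "\<forall>t. (f has_vector_derivative f' t) (at t)" "\<forall>t. (g has_vector_derivative g' t) (at t)"
      by auto
    then show ?case
      by (intro bexI[of _ "\<lambda>t. f' t + g' t"])
        (auto intro: sums_of_products.intros has_vector_derivative_add)
  qed
  then obtain h' where h': "h' \<in> sums_of_products" "\<And>t. (h has_vector_derivative h' t) (at t)"
    by blast
  have "vderiv h = h'" using h'(2) by (rule vderivI)
  then show "(\<forall>t. h differentiable (at t)) \<and> vderiv h \<in> sums_of_products"
    using h' differentiableI_vector by blast
qed (intro sums_of_products.intros assms)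

lemma nderiv_Suc_mult:
  assumes "smooth f" "smooth g"
  shows "(vderiv ^^ Suc n) (\<lambda>t. f t * g t) =
    (\<lambda>t. (vderiv ^^ n) (\<lambda>t. f t * vderiv g t) t + (vderiv ^^ n) (\<lambda>t. vderiv f t * g t) t)"
proof -
  have "vderiv (\<lambda>t. f t * g t) = (\<lambda>t. f t * vderiv g t + vderiv f t * g t)"
    by (rule vderivI) (rule vderiv_mult[OF assms])
  then show ?thesis
    using assms by (simp only: nderiv_Suc nderiv_add smooth_mult smooth_vderiv)
qed

text \<open>A crude Leibniz rule: every product rule doubles the number of terms, hence
  \<open>2 ^ n\<close> in place of binomial coefficients. It is pointwise in \<open>t\<close>, so
  that \<open>K\<close> and \<open>L\<close> may later contain a weight depending on
  \<open>t\<close>.\<close>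

lemma norm_nderiv_mult_le:
  assumes "smooth f" "smooth g"
    and "\<And>i. i \<le> n \<Longrightarrow> norm ((vderiv ^^ i) f t) \<le> K"
    and "\<And>i. i \<le> n \<Longrightarrow> norm ((vderiv ^^ i) g t) \<le> L"
  shows "norm ((vderiv ^^ n) (\<lambda>t. f t * g t) t) \<le> 2 ^ n * K * L"
  using assms
proof (induction n arbitrary: f g)
  case 0
  have "0 \<le> K" using "0"(3)[of 0] norm_ge_zero order_trans by blast
  moreover have "norm (f t) \<le> K" "norm (g t) \<le> L" using "0"(3,4)[of 0] by auto
  ultimately show ?case by (simp add: norm_mult mult_mono)
next
  case (Suc n)
  have *: "norm ((vderiv ^^ i) (vderiv f) t) \<le> K" "norm ((vderiv ^^ i) (vderiv g) t) \<le> L"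
    if "i \<le> n" for i
    using Suc.prems(3,4)[of "Suc i"] that by (simp_all only: nderiv_Suc Suc_le_mono)
  have "norm ((vderiv ^^ n) (\<lambda>t. f t * vderiv g t) t) \<le> 2 ^ n * K * L"
    using Suc.prems * by (intro Suc.IH) (auto simp: smooth_vderiv)
  moreover have "norm ((vderiv ^^ n) (\<lambda>t. vderiv f t * g t) t) \<le> 2 ^ n * K * L"
    using Suc.prems * by (intro Suc.IH) (auto simp: smooth_vderiv)
  ultimately show ?case
    unfolding nderiv_Suc_mult[OF Suc.prems(1,2)]
    by (intro order_trans[OF norm_triangle_ineq]) simp
qed

section \<open>Locality of derivatives\<close>

lemma vderiv_cong_ev:
  assumes "eventually (\<lambda>s. f s = g s) (nhds t)"
  shows "vderiv f t = vderiv g t"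
  unfolding vderiv_def using assms by (intro vector_derivative_cong_eq) auto

lemma nderiv_cong_open:
  assumes "open U" and "\<And>t. t \<in> U \<Longrightarrow> f t = g t" and "t \<in> U"
  shows "(vderiv ^^ n) f t = (vderiv ^^ n) g t"
  using assms(3)
proof (induction n arbitrary: t)
  case (Suc n)
  have "(vderiv ^^ n) f s = (vderiv ^^ n) g s" if "s \<in> U" for s using Suc.IH that by blast
  then have "eventually (\<lambda>s. (vderiv ^^ n) f s = (vderiv ^^ n) g s) (nhds t)"
    using assms(1) Suc.prems eventually_nhds by blast
  then show ?case
    using vderiv_cong_ev by simp
qed (simp add: assms)

lemma nderiv_const: "(vderiv ^^ n) (\<lambda>t. c) = (\<lambda>t. if n = 0 then c else 0)"
proof (induction n)
  case (Suc n)
  have "vderiv (\<lambda>t. a) = (\<lambda>t. 0)" for a :: complex by (rule vderivI) simp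
  then show ?case using Suc by simp
qed simp

lemma smooth_const: "smooth (\<lambda>t. c)"
  by (simp add: smooth_def nderiv_const)

lemma continuous_on_nderiv: "smooth f \<Longrightarrow> continuous_on A ((vderiv ^^ n) f)"
  by (meson continuous_at_imp_continuous_on differentiable_imp_continuous_within smooth_def)

subsection \<open>A smooth step\<close>

text \<open>The classical functions with all derivatives zero at 0. The polynomial factor in 1/t is
  there to make the family closed under differentiation.\<close>

definition flat :: "real poly \<Rightarrow> real \<Rightarrow> real" where
  "flat p t = (if t > 0 then poly p (1 / t) * exp (- 1 / t) else 0)"

lemma poly_div_exp_tendsto_0: "((\<lambda>x. poly q x * exp (- x)) \<longlongrightarrow> (0::real)) at_top"
proof -
  have "((\<lambda>x. \<Sum>i\<le>degree q. coeff q i * (x ^ i / exp x)) \<longlongrightarrow> (\<Sum>i\<le>degree q. coeff q i * 0)) at_top"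
    by (intro tendsto_intros tendsto_power_div_exp_0)
  then show ?thesis
    by (simp add: poly_altdef exp_minus field_simps sum_divide_distrib)
qed

lemma DERIV_flat: "(flat p has_real_derivative flat ([:0, 0, 1:] * (p - pderiv p)) t) (at t)"
proof -
  consider "t > 0" | "t < 0" | "t = 0" by linarith
  then show ?thesis
  proof cases
    case 1
    have d: "((\<lambda>t. poly p (1 / t) * exp (- 1 / t)) has_real_derivative
        flat ([:0, 0, 1:] * (p - pderiv p)) t) (at t)"
      using 1 by (auto intro!: derivative_eq_intros simp: flat_def field_simps power2_eq_square)
    have "eventually (\<lambda>s. s \<in> {0<..}) (nhds t)"
      using 1 by (intro eventually_nhds_in_open) auto
    then have ev: "eventually (\<lambda>s. poly p (1 / s) * exp (- 1 / s) = flat p s) (nhds t)"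
      by eventually_elim (auto simp: flat_def)
    show ?thesis by (rule iffD1[OF DERIV_cong_ev[OF refl ev refl] d])
  next
    case 2
    have "eventually (\<lambda>s. s \<in> {..<0}) (nhds t)"
      using 2 by (intro eventually_nhds_in_open) auto
    then have ev: "eventually (\<lambda>s. 0 = flat p s) (nhds t)"
      by eventually_elim (auto simp: flat_def)
    have d: "((\<lambda>t. 0) has_real_derivative flat ([:0, 0, 1:] * (p - pderiv p)) t) (at t)"
      using 2 by (simp add: flat_def)
    show ?thesis by (rule iffD1[OF DERIV_cong_ev[OF refl ev refl] d])
  next
    case 3
    \<comment> \<open>The right difference quotient at 0 divides by h, which multiplies the
      polynomial in 1/h by its variable; the exponential still wins.\<close>
    have "((\<lambda>h. poly ([:0, 1:] * p) (inverse h) * exp (- inverse h)) \<longlongrightarrow> 0) (at_right (0::real))"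
      by (rule filterlim_compose[OF poly_div_exp_tendsto_0 filterlim_inverse_at_top_right])
    moreover have "eventually (\<lambda>h. poly ([:0, 1:] * p) (inverse h) * exp (- inverse h)
        = (flat p (0 + h) - flat p 0) / h) (at_right 0)"
      using eventually_at_right_less[of 0]
      by eventually_elim (auto simp: flat_def field_simps)
    ultimately have r: "((\<lambda>h. (flat p (0 + h) - flat p 0) / h) \<longlongrightarrow> 0) (at_right 0)"
      by (rule Lim_transform_eventually)
    have "eventually (\<lambda>h. h \<in> {..<0}) (at_left (0::real))"
      by (simp add: eventually_at_filter)
    then have "eventually (\<lambda>h. 0 = (flat p (0 + h) - flat p 0) / h) (at_left 0)"
      by eventually_elim (auto simp: flat_def)
    then have "((\<lambda>h. (flat p (0 + h) - flat p 0) / h) \<longlongrightarrow> 0) (at_left 0)"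
      by (rule Lim_transform_eventually[OF tendsto_const])
    with r have "((\<lambda>h. (flat p (0 + h) - flat p 0) / h) \<longlongrightarrow> 0) (at 0)"
      by (simp add: filterlim_split_at)
    then show ?thesis using 3 by (simp add: DERIV_def flat_def)
  qed
qed

lemma smooth_flat: "smooth (\<lambda>t. of_real (flat p t))"
proof (rule smooth_coinduct[where X = "range (\<lambda>p t. of_real (flat p t))"])
  fix g :: "real \<Rightarrow> complex" assume "g \<in> range (\<lambda>p t. of_real (flat p t))"
  then obtain p where g: "g = (\<lambda>t. of_real (flat p t))" by auto
  have v: "(g has_vector_derivative of_real (flat ([:0, 0, 1:] * (p - pderiv p)) t)) (at t)" for t
    unfolding g using DERIV_flat
    by (intro has_vector_derivative_of_real) (simp add: has_real_derivative_iff_has_vector_derivative)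
  then have "vderiv g = (\<lambda>t. of_real (flat ([:0, 0, 1:] * (p - pderiv p)) t))"
    by (rule vderivI)
  then show "(\<forall>t. g differentiable (at t)) \<and> vderiv g \<in> range (\<lambda>p t. of_real (flat p t))"
    using v differentiableI_vector by blast
qed auto

lemma smooth_step_exists:
  "\<exists>\<sigma>. smooth \<sigma> \<and> (\<forall>t\<le>0. \<sigma> t = 0) \<and> (\<forall>t\<ge>1. \<sigma> t = 1)"
proof -
  \<comment> \<open>A bump that is positive exactly on the open unit interval. The step is its
    antiderivative, normalized to rise from 0 to 1.\<close>
  define b where "b = (\<lambda>t. flat 1 t * flat 1 (1 - t))"
  have sb: "smooth (\<lambda>t. of_real (b t))"
    using smooth_mult[OF smooth_flat[of 1] smooth_affine[OF smooth_flat[of 1], of 1 1 "-1"]]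
    by (simp add: b_def)
  have "isCont b t" for t
  proof -
    have "isCont (\<lambda>t. flat 1 (1 - t)) t"
      using isCont_o2[of t "\<lambda>t. 1 - t" "flat 1"] DERIV_isCont[OF DERIV_flat] by auto
    then show ?thesis
      unfolding b_def by (rule isCont_mult[OF DERIV_isCont[OF DERIV_flat]])
  qed
  then obtain F where F: "\<And>t. (F has_vector_derivative b t) (at t)"
    using einterval_antiderivative[of "-\<infinity>" \<infinity> b] by auto
  then have DF: "(F has_real_derivative b t) (at t)" for t
    by (simp add: has_real_derivative_iff_has_vector_derivative)
  have 0: "F t = F 0" if "t \<le> 0" for t
  proof (rule ccontr)
    assume "F t \<noteq> F 0"
    then have "t < 0" using that by (cases "t = 0") auto
    then obtain z where "z < 0" "F 0 - F t = (0 - t) * b z" using MVT2[of t 0 F b] DF by auto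
    then show False using \<open>F t \<noteq> F 0\<close> by (simp add: b_def flat_def)
  qed
  have 1: "F t = F 1" if "t \<ge> 1" for t
  proof (rule ccontr)
    assume "F t \<noteq> F 1"
    then have "1 < t" using that by (cases "t = 1") auto
    then obtain z where "z > 1" "F t - F 1 = (t - 1) * b z" using MVT2[of 1 t F b] DF by auto
    then show False using \<open>F t \<noteq> F 1\<close> by (simp add: b_def flat_def)
  qed
  \<comment> \<open>The mean value theorem expresses the total rise as a value of \<open>b\<close>
    inside the interval, so it is nonzero and one may divide by it.\<close>
  obtain z where z: "0 < z" "z < 1" "F 1 - F 0 = (1 - 0) * b z"
    using MVT2[of 0 1 F b] DF by auto
  then have ne: "F 1 - F 0 \<noteq> 0" by (simp add: b_def flat_def)
  define c where "c = inverse (F 1 - F 0)"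
  define \<sigma> :: "real \<Rightarrow> complex" where "\<sigma> = (\<lambda>t. of_real (c * (F t - F 0)))"
  have "((\<lambda>t. c * (F t - F 0)) has_vector_derivative c * b t) (at t)" for t
    using DF[of t] unfolding has_real_derivative_iff_has_vector_derivative[symmetric]
    by (auto intro!: derivative_eq_intros)
  then have "(\<sigma> has_vector_derivative of_real (c * b t)) (at t)" for t
    unfolding \<sigma>_def
    by (intro has_vector_derivative_of_real) (simp add: has_real_derivative_iff_has_vector_derivative)
  then have "smooth \<sigma>"
    by (rule smooth_from_vderiv) (use smooth_cmult[OF sb, of "of_real c"] in simp)
  moreover have "\<sigma> t = 0" if "t \<le> 0" for t using 0[OF that] by (simp add: \<sigma>_def)
  moreover have "\<sigma> t = 1" if "t \<ge> 1" for t using 1[OF that] ne by (simp add: \<sigma>_def c_def)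
  ultimately show ?thesis by blast
qed

definition smooth_step :: "real \<Rightarrow> complex" where
  "smooth_step = (SOME \<sigma>. smooth \<sigma> \<and> (\<forall>t\<le>0. \<sigma> t = 0) \<and> (\<forall>t\<ge>1. \<sigma> t = 1))"

lemma smooth_step:
  "smooth smooth_step" "t \<le> 0 \<Longrightarrow> smooth_step t = 0" "t \<ge> 1 \<Longrightarrow> smooth_step t = 1"
  using someI_ex[OF smooth_step_exists, folded smooth_step_def] by auto

lemma nderiv_smooth_step_0: "t < 0 \<Longrightarrow> (vderiv ^^ n) smooth_step t = 0"
  using nderiv_cong_open[of "{..<0}" smooth_step "\<lambda>_. 0" t n] smooth_step
  by (simp add: nderiv_const split: if_splits)

lemma nderiv_smooth_step_1: "t > 1 \<Longrightarrow> (vderiv ^^ n) smooth_step t = (if n = 0 then 1 else 0)"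
  using nderiv_cong_open[of "{1<..}" smooth_step "\<lambda>_. 1" t n] smooth_step
  by (simp add: nderiv_const split: if_splits)

text \<open>On the unit interval compactness gives a bound; elsewhere the step is locally constant.
  Summing the bounds of the single orders gives one \<open>K\<close> for all orders up to
  \<open>n\<close>.\<close>

lemma nderiv_smooth_step_bounded: "\<exists>K\<ge>0. \<forall>i\<le>n. \<forall>t. norm ((vderiv ^^ i) smooth_step t) \<le> K"
proof -
  have "\<exists>K\<ge>0. \<forall>t. norm ((vderiv ^^ i) smooth_step t) \<le> K" for i
  proof -
    have "bounded ((vderiv ^^ i) smooth_step ` {0..1})"
      by (intro compact_imp_bounded compact_continuous_image continuous_on_nderiv smooth_step) auto
    then obtain K where K: "\<And>t. t \<in> {0..1} \<Longrightarrow> norm ((vderiv ^^ i) smooth_step t) \<le> K"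
      unfolding bounded_iff by blast
    have "norm ((vderiv ^^ i) smooth_step t) \<le> max K 1" for t
    proof -
      consider "t < 0" | "t > 1" | "t \<in> {0..1}" by fastforce
      then show ?thesis
        by cases (auto simp: nderiv_smooth_step_0 nderiv_smooth_step_1 intro: order_trans[OF K])
    qed
    then show ?thesis by (intro exI[of _ "max K 1"]) auto
  qed
  then obtain K where K: "\<And>i. K i \<ge> 0" "\<And>i t. norm ((vderiv ^^ i) smooth_step t) \<le> K i"
    by metis
  show ?thesis
  proof (intro exI[of _ "\<Sum>i\<le>n. K i"] conjI allI impI)
    fix i t assume "i \<le> n"
    then have "K i \<le> (\<Sum>i\<le>n. K i)" using K(1) by (intro member_le_sum) auto
    then show "norm ((vderiv ^^ i) smooth_step t) \<le> (\<Sum>i\<le>n. K i)" using K(2) order_trans by blast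
  qed (use K in \<open>auto intro: sum_nonneg\<close>)
qed

section \<open>Schwartz functions and causal tempered distributions\<close>

text \<open>One index for both the weight and the number of derivatives gives an increasing scale of
  norms, equivalent to the finite sums of Schwartz seminorms. The weight is at least 1, so one can
  divide by it, and stating a bound \<open>A\<close> avoids suprema.\<close>

definition schwartz_le :: "nat \<Rightarrow> (real \<Rightarrow> complex) \<Rightarrow> real \<Rightarrow> bool" where
  "schwartz_le M f A \<longleftrightarrow> (\<forall>n\<le>M. \<forall>t. (1 + \<bar>t\<bar>) ^ M * norm ((vderiv ^^ n) f t) \<le> A)"

lemma schwartz_leD:
  assumes "schwartz_le M f A" "n \<le> M" "k \<le> M"
  shows "(1 + \<bar>t\<bar>) ^ k * norm ((vderiv ^^ n) f t) \<le> A"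
proof -
  have "(1 + \<bar>t\<bar>) ^ k * norm ((vderiv ^^ n) f t) \<le> (1 + \<bar>t\<bar>) ^ M * norm ((vderiv ^^ n) f t)"
    using assms(3) by (intro mult_right_mono power_increasing) auto
  also have "\<dots> \<le> A" using assms unfolding schwartz_le_def by blast
  finally show ?thesis .
qed

lemma schwartz_le_power_abs:
  assumes "schwartz_le M f A" "n \<le> M" "k \<le> M"
  shows "\<bar>t\<bar> ^ k * norm ((vderiv ^^ n) f t) \<le> A"
proof -
  have "\<bar>t\<bar> ^ k * norm ((vderiv ^^ n) f t) \<le> (1 + \<bar>t\<bar>) ^ k * norm ((vderiv ^^ n) f t)"
    by (intro mult_right_mono power_mono) auto
  then show ?thesis using schwartz_leD[OF assms] order_trans by blast
qed

lemma schwartz_le_mono: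
  assumes "schwartz_le M f A" "k \<le> M"
  shows "schwartz_le k f A"
  unfolding schwartz_le_def using schwartz_leD[OF assms(1) _ assms(2)] assms(2) by auto

lemma schwartz_le_nonneg: "schwartz_le M f A \<Longrightarrow> 0 \<le> A"
  using schwartz_leD[of M f A 0 0 0] order_trans[OF norm_ge_zero, of "f 0" A] by simp

lemma schwartz_le_nderiv:
  assumes "schwartz_le (M + n) f A"
  shows "schwartz_le M ((vderiv ^^ n) f) A"
  unfolding schwartz_le_def
proof (intro allI impI)
  fix i t assume "i \<le> M"
  have "(vderiv ^^ i) ((vderiv ^^ n) f) = (vderiv ^^ (i + n)) f" by (simp add: funpow_add)
  then show "(1 + \<bar>t\<bar>) ^ M * norm ((vderiv ^^ i) ((vderiv ^^ n) f) t) \<le> A"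
    using schwartz_leD[OF assms, of "i + n" M t] \<open>i \<le> M\<close> by simp
qed

lemma schwartz_seminorm_upper:
  assumes "schwartz f"
  shows "\<bar>t\<bar> ^ k * norm ((vderiv ^^ n) f t) \<le> schwartz_seminorm k n f"
  unfolding schwartz_seminorm_def using assms
  by (intro cSUP_upper bounded_imp_bdd_above) (auto simp: schwartz_def)

lemma schwartz_seminorm_nonneg: "schwartz f \<Longrightarrow> 0 \<le> schwartz_seminorm k n f"
  using schwartz_seminorm_upper[of f 0 k n] by (smt (verit) mult_nonneg_nonneg norm_ge_zero zero_le_power abs_ge_zero)

lemma schwartz_le_seminorms:
  assumes "schwartz f"
  shows "schwartz_le M f (2 ^ Suc M * (\<Sum>k\<le>M. \<Sum>n\<le>M. schwartz_seminorm k n f))"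
  unfolding schwartz_le_def
proof (intro allI impI)
  fix n t assume n: "n \<le> M"
  define S where "S = (\<Sum>k\<le>M. \<Sum>n\<le>M. schwartz_seminorm k n f)"
  have S: "\<bar>t\<bar> ^ k * norm ((vderiv ^^ n) f t) \<le> S" if "k \<le> M" for k
  proof -
    have "schwartz_seminorm k n f \<le> (\<Sum>n\<le>M. schwartz_seminorm k n f)"
      using n by (intro member_le_sum schwartz_seminorm_nonneg assms) auto
    also have "\<dots> \<le> S"
      unfolding S_def using that
      by (intro member_le_sum[of k "{..M}" "\<lambda>k. \<Sum>n\<le>M. schwartz_seminorm k n f"])
        (auto intro!: sum_nonneg schwartz_seminorm_nonneg assms)
    finally show ?thesis using schwartz_seminorm_upper[OF assms] order_trans by blast
  qed
  \<comment> \<open>The weight is dominated by the powers 0 and \<open>M\<close> of |t|. Each of the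
    two resulting terms is at most \<open>S\<close>, hence the constant
    \<open>2 ^ Suc M\<close>.\<close>
  have "(1 + \<bar>t\<bar>) ^ M \<le> 2 ^ M * (1 + \<bar>t\<bar> ^ M)"
  proof (cases "\<bar>t\<bar> \<le> 1")
    case True
    then have "(1 + \<bar>t\<bar>) ^ M \<le> 2 ^ M" by (intro power_mono) auto
    also have "\<dots> \<le> 2 ^ M * (1 + \<bar>t\<bar> ^ M)" by simp
    finally show ?thesis .
  next
    case False
    then have "(1 + \<bar>t\<bar>) ^ M \<le> (2 * \<bar>t\<bar>) ^ M" by (intro power_mono) auto
    also have "\<dots> \<le> 2 ^ M * (1 + \<bar>t\<bar> ^ M)" by (simp add: power_mult_distrib)
    finally show ?thesis .
  qed
  then have "(1 + \<bar>t\<bar>) ^ M * norm ((vderiv ^^ n) f t) \<le> 2 ^ M * (1 + \<bar>t\<bar> ^ M) * norm ((vderiv ^^ n) f t)"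
    by (intro mult_right_mono) auto
  also have "\<dots> = 2 ^ M * (\<bar>t\<bar> ^ 0 * norm ((vderiv ^^ n) f t) + \<bar>t\<bar> ^ M * norm ((vderiv ^^ n) f t))"
    by (simp add: algebra_simps)
  also have "\<dots> \<le> 2 ^ M * (S + S)"
    using S[of 0] S[of M] by (intro mult_left_mono add_mono) auto
  finally show "(1 + \<bar>t\<bar>) ^ M * norm ((vderiv ^^ n) f t) \<le> 2 ^ Suc M * S" by simp
qed

lemma schwartz_iff: "schwartz f \<longleftrightarrow> smooth f \<and> (\<forall>M. \<exists>A. schwartz_le M f A)"
proof (intro iffI conjI allI)
  assume r: "smooth f \<and> (\<forall>M. \<exists>A. schwartz_le M f A)"
  show "schwartz f"
    unfolding schwartz_def bounded_iff
  proof (intro conjI allI)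
    fix k n
    obtain A where A: "schwartz_le (k + n) f A" using r by blast
    have "\<bar>t\<bar> ^ k * norm ((vderiv ^^ n) f t) \<le> A" for t
      using schwartz_le_power_abs[OF A, of n k t] by simp
    then show "\<exists>a. \<forall>x\<in>range (\<lambda>t. \<bar>t\<bar> ^ k * norm ((vderiv ^^ n) f t)). norm x \<le> a"
      by auto
  qed (use r in blast)
qed (use schwartz_le_seminorms in \<open>auto simp: schwartz_def\<close>)

lemma schwartz_smooth: "schwartz f \<Longrightarrow> smooth f"
  by (simp add: schwartz_def)

lemma schwartz_add:
  assumes "schwartz f" "schwartz g"
  shows "schwartz (\<lambda>t. f t + g t)"
  unfolding schwartz_iff
proof (intro conjI allI)
  have s: "smooth f" "smooth g" using assms by (auto intro: schwartz_smooth)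
  then show "smooth (\<lambda>t. f t + g t)" by (rule smooth_add)
  fix M
  obtain A B where "schwartz_le M f A" "schwartz_le M g B" using assms schwartz_iff by blast
  then have "(1 + \<bar>t\<bar>) ^ M * (norm ((vderiv ^^ n) f t) + norm ((vderiv ^^ n) g t)) \<le> A + B"
    if "n \<le> M" for n t
    using that unfolding schwartz_le_def distrib_left by (intro add_mono) auto
  moreover have "(1 + \<bar>t\<bar>) ^ M * norm ((vderiv ^^ n) f t + (vderiv ^^ n) g t)
      \<le> (1 + \<bar>t\<bar>) ^ M * (norm ((vderiv ^^ n) f t) + norm ((vderiv ^^ n) g t))" for n t
    by (intro mult_left_mono norm_triangle_ineq) auto
  ultimately have "schwartz_le M (\<lambda>t. f t + g t) (A + B)"
    unfolding schwartz_le_def nderiv_add[OF s] using order_trans by blast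
  then show "\<exists>A. schwartz_le M (\<lambda>t. f t + g t) A" ..
qed

lemma schwartz_cmult:
  assumes "schwartz f"
  shows "schwartz (\<lambda>t. c * f t)"
  unfolding schwartz_iff
proof (intro conjI allI)
  have s: "smooth f" using assms by (auto intro: schwartz_smooth)
  then show "smooth (\<lambda>t. c * f t)" by (rule smooth_cmult)
  fix M
  obtain A where A: "schwartz_le M f A" using assms schwartz_iff by blast
  have "(1 + \<bar>t\<bar>) ^ M * norm (c * (vderiv ^^ n) f t) \<le> norm c * A" if "n \<le> M" for n t
    using mult_left_mono[OF schwartz_leD[OF A that order_refl, of t] norm_ge_zero[of c]]
    by (simp add: norm_mult mult_ac)
  then have "schwartz_le M (\<lambda>t. c * f t) (norm c * A)"
    unfolding schwartz_le_def nderiv_cmult[OF s] by blast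
  then show "\<exists>A. schwartz_le M (\<lambda>t. c * f t) A" ..
qed

lemma schwartz_nderiv:
  assumes "schwartz f"
  shows "schwartz ((vderiv ^^ n) f)"
  using assms schwartz_le_nderiv smooth_nderiv unfolding schwartz_iff by blast

lemma schwartz_translate:
  assumes "schwartz f"
  shows "schwartz (\<lambda>t. f (a + t))"
  unfolding schwartz_iff
proof (intro conjI allI)
  have s: "smooth f" using assms by (auto intro: schwartz_smooth)
  then show "smooth (\<lambda>t. f (a + t))" by (rule smooth_translate)
  fix M
  obtain A where A: "schwartz_le M f A" using assms schwartz_iff by blast
  have "(1 + \<bar>t\<bar>) ^ M * norm ((vderiv ^^ n) f (a + t)) \<le> (1 + \<bar>a\<bar>) ^ M * A" if "n \<le> M" for n t
  proof -
    \<comment> \<open>Translating by \<open>a\<close> changes the weight by at most the factor 1 +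
      |a| per power.\<close>
    have "1 + \<bar>t\<bar> \<le> (1 + \<bar>a\<bar>) * (1 + \<bar>a + t\<bar>)"
      using mult_nonneg_nonneg[OF abs_ge_zero abs_ge_zero, of a "a + t"]
      unfolding distrib_left distrib_right mult_1_right mult_1_left by linarith
    then have "(1 + \<bar>t\<bar>) ^ M \<le> (1 + \<bar>a\<bar>) ^ M * (1 + \<bar>a + t\<bar>) ^ M"
      unfolding power_mult_distrib[symmetric] by (intro power_mono) auto
    then have "(1 + \<bar>t\<bar>) ^ M * norm ((vderiv ^^ n) f (a + t))
        \<le> (1 + \<bar>a\<bar>) ^ M * (1 + \<bar>a + t\<bar>) ^ M * norm ((vderiv ^^ n) f (a + t))"
      by (intro mult_right_mono) auto
    also have "\<dots> \<le> (1 + \<bar>a\<bar>) ^ M * A"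
      using schwartz_leD[OF A that order_refl, of "a + t"] by (simp add: mult.assoc mult_left_mono)
    finally show ?thesis .
  qed
  then have "schwartz_le M (\<lambda>t. f (a + t)) ((1 + \<bar>a\<bar>) ^ M * A)"
    unfolding schwartz_le_def nderiv_translate[OF s] by blast
  then show "\<exists>A. schwartz_le M (\<lambda>t. f (a + t)) A" ..
qed

text \<open>The transition lies in [-2, -1]: the cutoff is 1 on a neighbourhood of the half-line
  with room to spare, and products with it only need to be estimated for t >= -2.\<close>

definition cutoff :: "real \<Rightarrow> complex" where
  "cutoff t = smooth_step (2 + t)"

lemma smooth_cutoff: "smooth cutoff"
  unfolding cutoff_def[abs_def] by (rule smooth_translate[OF smooth_step(1)])

lemma cutoff_1: "t \<ge> -1 \<Longrightarrow> cutoff t = 1"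
  by (simp add: cutoff_def smooth_step)

lemma nderiv_cutoff: "(vderiv ^^ n) cutoff t = (vderiv ^^ n) smooth_step (2 + t)"
  unfolding cutoff_def[abs_def] by (simp add: nderiv_translate smooth_step)

lemma nderiv_cutoff_mult_0:
  assumes "smooth g" "t < -2"
  shows "(vderiv ^^ n) (\<lambda>t. cutoff t * g t) t = 0"
  using nderiv_cong_open[of "{..< -2}" "\<lambda>t. cutoff t * g t" "\<lambda>t. 0" t n] assms
  by (simp add: nderiv_const cutoff_def smooth_step)

text \<open>\<open>g\<close> need only decay to the right, which is the case of exponentials and of
  \<open>shift_pairing\<close>. That \<open>K\<close> depends on \<open>M\<close> alone is what
  later makes the convolution continuous in the test function.\<close>

lemma schwartz_le_cutoff_mult:
  "\<exists>K\<ge>0. \<forall>g A. smooth g \<longrightarrow>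
     (\<forall>n\<le>M. \<forall>t\<ge>-2. (1 + \<bar>t\<bar>) ^ M * norm ((vderiv ^^ n) g t) \<le> A) \<longrightarrow>
     schwartz_le M (\<lambda>t. cutoff t * g t) (K * A)"
proof -
  obtain K where K: "K \<ge> 0" "\<And>i t. i \<le> M \<Longrightarrow> norm ((vderiv ^^ i) smooth_step t) \<le> K"
    using nderiv_smooth_step_bounded[of M] by blast
  show ?thesis
  proof (intro exI[of _ "2 ^ M * K"] conjI allI impI)
    show "0 \<le> 2 ^ M * K" using K by simp
  next
    fix g A
    assume g: "smooth g" and A: "\<forall>n\<le>M. \<forall>t\<ge>-2. (1 + \<bar>t\<bar>) ^ M * norm ((vderiv ^^ n) g t) \<le> A"
    have A0: "0 \<le> A" using order_trans[OF norm_ge_zero, of "g 0" A] A[rule_format, of 0 0] by simp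
    show "schwartz_le M (\<lambda>t. cutoff t * g t) (2 ^ M * K * A)"
      unfolding schwartz_le_def
    proof (intro allI impI)
      fix n t assume n: "n \<le> M"
      show "(1 + \<bar>t\<bar>) ^ M * norm ((vderiv ^^ n) (\<lambda>t. cutoff t * g t) t) \<le> 2 ^ M * K * A"
      proof (cases "t < -2")
        case True
        then show ?thesis using nderiv_cutoff_mult_0[OF g True] K A0 by simp
      next
        case False
        define w where "w = (1 + \<bar>t\<bar>) ^ M"
        have w: "w > 0" by (simp add: w_def add_pos_nonneg)
        have "norm ((vderiv ^^ n) (\<lambda>t. cutoff t * g t) t) \<le> 2 ^ n * K * (A / w)"
          using False n A w K(2) unfolding w_def[symmetric]
          by (intro norm_nderiv_mult_le smooth_cutoff g)
            (auto simp: nderiv_cutoff field_simps w_def)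
        also have "\<dots> \<le> 2 ^ M * K * (A / w)"
          using n K A0 w by (intro mult_right_mono power_increasing) auto
        finally show ?thesis using w unfolding w_def[symmetric] by (simp add: field_simps)
      qed
    qed
  qed
qed

section \<open>Causal tempered distributions depend only on germs along the half-line\<close>

lemma tempered_add:
  "tempered_distribution T \<Longrightarrow> schwartz f \<Longrightarrow> schwartz g \<Longrightarrow> T (\<lambda>t. f t + g t) = T f + T g"
  by (simp add: tempered_distribution_def)

lemma tempered_cmult:
  "tempered_distribution T \<Longrightarrow> schwartz f \<Longrightarrow> T (\<lambda>t. c * f t) = c * T f"
  by (simp add: tempered_distribution_def)

lemma tempered_diff:
  "tempered_distribution T \<Longrightarrow> schwartz f \<Longrightarrow> schwartz g \<Longrightarrow> T (\<lambda>t. f t - g t) = T f - T g"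
  using tempered_add[of T f "\<lambda>t. - 1 * g t"] tempered_cmult[of T g "-1"] schwartz_cmult[of g "-1"]
  by simp

lemma schwartz_diff: "schwartz f \<Longrightarrow> schwartz g \<Longrightarrow> schwartz (\<lambda>t. f t - g t)"
  using schwartz_add[of f "\<lambda>t. - 1 * g t"] schwartz_cmult[of g "-1"] by simp

text \<open>Continuity in terms of \<open>schwartz_le\<close>. The sum has (N + 1)^2 seminorms, each
  at most \<open>A\<close>; taking |C| makes the constant nonnegative, so that bounds can be
  multiplied.\<close>

lemma tempered_bound:
  assumes "tempered_distribution T"
  obtains C N where "C \<ge> 0" "\<And>f A. schwartz f \<Longrightarrow> schwartz_le N f A \<Longrightarrow> norm (T f) \<le> C * A"
proof -
  obtain C N where C: "\<And>f. schwartz f \<Longrightarrow>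
      norm (T f) \<le> C * (\<Sum>k\<le>N. \<Sum>n\<le>N. schwartz_seminorm k n f)"
    using assms unfolding tempered_distribution_def by blast
  have "norm (T f) \<le> (\<bar>C\<bar> * (real (Suc N) * real (Suc N))) * A"
    if f: "schwartz f" "schwartz_le N f A" for f A
  proof -
    have "schwartz_seminorm k n f \<le> A" if "k \<le> N" "n \<le> N" for k n
      unfolding schwartz_seminorm_def
    proof (rule cSUP_least)
      fix t :: real
      show "\<bar>t\<bar> ^ k * norm ((vderiv ^^ n) f t) \<le> A"
        by (rule schwartz_le_power_abs[OF f(2) that(2,1)])
    qed auto
    then have "(\<Sum>k\<le>N. \<Sum>n\<le>N. schwartz_seminorm k n f) \<le> (\<Sum>k\<le>N. \<Sum>n\<le>N. A)"
      by (intro sum_mono) auto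
    also have "\<dots> = real (Suc N) * real (Suc N) * A" by simp
    finally have "\<bar>C\<bar> * (\<Sum>k\<le>N. \<Sum>n\<le>N. schwartz_seminorm k n f)
        \<le> \<bar>C\<bar> * (real (Suc N) * real (Suc N) * A)"
      by (intro mult_left_mono) auto
    moreover have "C * (\<Sum>k\<le>N. \<Sum>n\<le>N. schwartz_seminorm k n f)
        \<le> \<bar>C\<bar> * (\<Sum>k\<le>N. \<Sum>n\<le>N. schwartz_seminorm k n f)"
      using f(1) by (intro mult_right_mono sum_nonneg schwartz_seminorm_nonneg) auto
    ultimately show ?thesis using C[OF f(1)] by (simp add: mult.assoc)
  qed
  then show ?thesis by (intro that[of "\<bar>C\<bar> * (real (Suc N) * real (Suc N))" N]) auto
qed

lemma schwartz_test_function: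
  assumes "test_function f"
  shows "schwartz f"
  unfolding schwartz_def
proof (intro conjI allI)
  show sf: "smooth f" using assms by (simp add: test_function_def)
  fix k n
  define Z where "Z = closure {t. f t \<noteq> 0}"
  define w where "w = (\<lambda>t. \<bar>t\<bar> ^ k * norm ((vderiv ^^ n) f t))"
  have "compact Z" using assms by (simp add: test_function_def Z_def)
  then have "bounded (w ` Z)"
    unfolding w_def
    by (intro compact_imp_bounded compact_continuous_image continuous_intros continuous_on_nderiv sf)
  moreover have "w t = 0" if "t \<notin> Z" for t
  proof -
    have "open (- Z)" unfolding Z_def by (intro open_Compl closed_closure)
    moreover have "f s = 0" if "s \<in> - Z" for s
      using that subsetD[OF closure_subset, of s "{t. f t \<noteq> 0}"] unfolding Z_def by blast
    ultimately have "(vderiv ^^ n) f t = (vderiv ^^ n) (\<lambda>t. 0) t"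
      by (rule nderiv_cong_open) (use that in blast)+
    then show ?thesis by (simp add: w_def nderiv_const)
  qed
  then have "range w \<subseteq> insert 0 (w ` Z)" by blast
  ultimately show "bounded (range (\<lambda>t. \<bar>t\<bar> ^ k * norm ((vderiv ^^ n) f t)))"
    unfolding w_def using bounded_subset bounded_insert by blast
qed

text \<open>Support is tested on compactly supported functions only, so \<open>g\<close> is
  truncated far to the left. \<open>T\<close> vanishes on the truncations, and continuity carries
  this over to \<open>g\<close>.\<close>

lemma causal_zero:
  assumes T: "tempered_distribution T" "causal T"
    and g: "schwartz g" "\<epsilon> > 0" "\<And>t. t > - \<epsilon> \<Longrightarrow> g t = 0"
  shows "T g = 0"
proof -
  obtain C N where C: "C \<ge> 0" "\<And>f A. schwartz f \<Longrightarrow> schwartz_le N f A \<Longrightarrow> norm (T f) \<le> C * A"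
    using tempered_bound[OF T(1)] by blast
  \<comment> \<open>One power of decay more than the order \<open>N\<close> of \<open>T\<close>; it
    supplies the convergence of the truncations.\<close>
  obtain A where A: "schwartz_le (Suc N) g A" using g(1) schwartz_iff by blast
  obtain K where K: "K \<ge> 0" "\<And>i t. i \<le> N \<Longrightarrow> norm ((vderiv ^^ i) smooth_step t) \<le> K"
    using nderiv_smooth_step_bounded[of N] by blast
  have sg: "smooth g" using g(1) by (rule schwartz_smooth)
  have bound: "norm (T g) \<le> C * ((1 + 2 ^ N * K) * A) / real (Suc m)" for m :: nat
  proof -
    \<comment> \<open>\<open>g\<close> and its truncation agree for t > 1 - a. Elsewhere 1 + |t| is
      at least m + 1, so the spare power of decay contributes a factor 1 / (m + 1).\<close>
    define a where "a = real m + 2"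
    \<comment> \<open>\<open>h\<close> has compact support and tends to \<open>g\<close> in the Schwartz topology as \<open>m\<close> grows\<close>
    define h where "h = (\<lambda>t. smooth_step (a + t) * g t)"
    have sh: "smooth h"
      unfolding h_def by (intro smooth_mult smooth_translate smooth_step sg)
    have "{t. h t \<noteq> 0} \<subseteq> {- a..- \<epsilon>}"
    proof
      fix t assume t: "t \<in> {t. h t \<noteq> 0}"
      then have "\<not> a + t \<le> 0" "\<not> t > - \<epsilon>" using smooth_step(2) g(3) by (auto simp: h_def)
      then show "t \<in> {- a..- \<epsilon>}" by auto
    qed
    then have cl: "closure {t. h t \<noteq> 0} \<subseteq> {- a..- \<epsilon>}" by (rule closure_minimal) auto
    then have "compact (closure {t. h t \<noteq> 0})"
      using bounded_subset[OF bounded_closed_interval] compact_eq_bounded_closed by blast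
    with sh have th: "test_function h" by (simp add: test_function_def)
    then have sch: "schwartz h" by (rule schwartz_test_function)
    have "closure {t. h t \<noteq> 0} \<inter> {0..} = {}" using cl g(2) by fastforce
    with th have Th: "T h = 0"
      using T(2) unfolding causal_def supported_in_def by blast
    have nh: "norm ((vderiv ^^ n) h t) \<le> 2 ^ n * K * (A / (1 + \<bar>t\<bar>) ^ Suc N)" if "n \<le> N" for n t
      unfolding h_def
    proof (rule norm_nderiv_mult_le)
      fix i assume "i \<le> n"
      then show "norm ((vderiv ^^ i) (\<lambda>t. smooth_step (a + t)) t) \<le> K"
        using K(2) that by (simp add: nderiv_translate smooth_step)
      have "(1 + \<bar>t\<bar>) ^ Suc N > 0" by (simp add: add_pos_nonneg)
      then show "norm ((vderiv ^^ i) g t) \<le> A / (1 + \<bar>t\<bar>) ^ Suc N"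
        using schwartz_leD[OF A, of i "Suc N" t] \<open>i \<le> n\<close> that by (simp add: pos_le_divide_eq mult.commute)
    qed (use sg smooth_translate smooth_step in auto)
    have A0: "A \<ge> 0" using A by (rule schwartz_le_nonneg)
    have main: "schwartz_le N (\<lambda>t. g t - h t) ((1 + 2 ^ N * K) * A / real (Suc m))"
      unfolding schwartz_le_def
    proof (intro allI impI)
      fix n t assume n: "n \<le> N"
      show "(1 + \<bar>t\<bar>) ^ N * norm ((vderiv ^^ n) (\<lambda>t. g t - h t) t) \<le> (1 + 2 ^ N * K) * A / real (Suc m)"
      proof (cases "t > 1 - a")
        case True
        have "(vderiv ^^ n) (\<lambda>t. g t - h t) t = (vderiv ^^ n) (\<lambda>t. 0) t"
          by (rule nderiv_cong_open[of "{1 - a<..}"]) (use True in \<open>auto simp: h_def smooth_step\<close>)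
        then show ?thesis using A0 K by (simp add: nderiv_const)
      next
        case False
        then have at: "1 + \<bar>t\<bar> \<ge> real (Suc m)" by (simp add: a_def)
        have eq: "(vderiv ^^ n) (\<lambda>t. g t - h t) t = (vderiv ^^ n) g t - (vderiv ^^ n) h t"
          using nderiv_add[OF sg smooth_cmult[OF sh, of "-1"], of n] nderiv_cmult[OF sh, of n "-1"]
          by simp
        define w where "w = (1 + \<bar>t\<bar>) ^ N"
        have w: "w > 0" by (simp add: w_def add_pos_nonneg)
        have t1: "1 + \<bar>t\<bar> > 0" by simp
        have "norm ((vderiv ^^ n) g t) \<le> A / (1 + \<bar>t\<bar>) ^ Suc N"
          using schwartz_leD[OF A, of n "Suc N" t] n t1 by (simp add: pos_le_divide_eq mult.commute)
        moreover have "norm ((vderiv ^^ n) h t) \<le> 2 ^ N * K * (A / (1 + \<bar>t\<bar>) ^ Suc N)"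
        proof (rule order_trans[OF nh[OF n]])
          show "2 ^ n * K * (A / (1 + \<bar>t\<bar>) ^ Suc N) \<le> 2 ^ N * K * (A / (1 + \<bar>t\<bar>) ^ Suc N)"
            using n K A0 by (intro mult_right_mono power_increasing) auto
        qed
        ultimately have "norm ((vderiv ^^ n) (\<lambda>t. g t - h t) t)
            \<le> A / (1 + \<bar>t\<bar>) ^ Suc N + 2 ^ N * K * (A / (1 + \<bar>t\<bar>) ^ Suc N)"
          unfolding eq by (intro order_trans[OF norm_triangle_ineq4] add_mono)
        also have "\<dots> = (1 + 2 ^ N * K) * A / (w * (1 + \<bar>t\<bar>))"
          by (simp add: w_def algebra_simps add_divide_distrib)
        finally have "w * norm ((vderiv ^^ n) (\<lambda>t. g t - h t) t)
            \<le> w * ((1 + 2 ^ N * K) * A / (w * (1 + \<bar>t\<bar>)))"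
          using w by (intro mult_left_mono) auto
        also have "\<dots> = (1 + 2 ^ N * K) * A / (1 + \<bar>t\<bar>)" using w by simp
        also have "\<dots> \<le> (1 + 2 ^ N * K) * A / real (Suc m)"
          using at A0 K t1 by (intro divide_left_mono) (auto intro!: mult_nonneg_nonneg add_nonneg_nonneg)
        finally show ?thesis unfolding w_def .
      qed
    qed
    have "norm (T (\<lambda>t. g t - h t)) \<le> C * ((1 + 2 ^ N * K) * A / real (Suc m))"
      by (rule C(2)[OF schwartz_diff[OF g(1) sch] main])
    then show ?thesis using tempered_diff[OF T(1) g(1) sch] Th by simp
  qed
  have "(\<lambda>m. C * ((1 + 2 ^ N * K) * A) / real (Suc m)) \<longlonglongrightarrow> 0"
    by (intro LIMSEQ_Suc lim_const_over_n)
  then have "norm (T g) \<le> 0" using bound by (intro LIMSEQ_le_const) auto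
  then show ?thesis by simp
qed

text \<open>Two representatives differ by a Schwartz function that is zero near the half-line, on
  the smaller of their two neighbourhoods, so \<open>causal_zero\<close> makes the choice by
  \<open>SOME\<close> harmless.\<close>

lemma causal_pairing_eq:
  assumes T: "tempered_distribution T" "causal T"
    and g: "schwartz g" "\<epsilon> > 0" "\<And>t. t > - \<epsilon> \<Longrightarrow> g t = f t"
  shows "causal_pairing T f = T g"
proof -
  define h where "h = (SOME g. schwartz g \<and> (\<exists>\<epsilon>>0. \<forall>t>-\<epsilon>. g t = f t))"
  have "schwartz h \<and> (\<exists>\<epsilon>>0. \<forall>t>-\<epsilon>. h t = f t)"
    unfolding h_def by (rule someI[of _ g]) (use g in blast)
  then obtain \<delta> where h: "schwartz h" "\<delta> > 0" "\<And>t. t > - \<delta> \<Longrightarrow> h t = f t" by blast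
  have "T (\<lambda>t. h t - g t) = 0"
    by (rule causal_zero[OF T schwartz_diff[OF h(1) g(1)], of "min \<delta> \<epsilon>"])
      (use g h in auto)
  then show ?thesis
    using tempered_diff[OF T(1) h(1) g(1)] by (simp add: causal_pairing_def h_def)
qed

lemma causal_cong:
  assumes "tempered_distribution T" "causal T" "schwartz f" "schwartz g"
    and "\<epsilon> > 0" "\<And>t. t > - \<epsilon> \<Longrightarrow> f t = g t"
  shows "T f = T g"
  using causal_pairing_eq[of T f \<epsilon> g] causal_pairing_eq[of T g \<epsilon> g] assms by metis

text \<open>For complex values the mean value theorem holds only as an inequality. It is applied
  twice, first to \<open>f'\<close> and then to \<open>f\<close>, which gives
  \<open>h\<^sup>2 * B\<close> without the usual factor 1/2.\<close>

lemma norm_taylor_le: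
  fixes f :: "real \<Rightarrow> complex"
  assumes f: "\<And>t. (f has_vector_derivative f' t) (at t)" "\<And>t. (f' has_vector_derivative f'' t) (at t)"
    and B: "\<And>s. \<bar>s - u\<bar> \<le> \<bar>h\<bar> \<Longrightarrow> norm (f'' s) \<le> B"
  shows "norm (f (u + h) - f u - of_real h * f' u) \<le> h\<^sup>2 * B"
proof -
  \<comment> \<open>Symmetric around \<open>u\<close>, because \<open>h\<close> may have either
    sign.\<close>
  define S where "S = {u - \<bar>h\<bar>..u + \<bar>h\<bar>}"
  have cS: "convex S" and u: "u \<in> S" and uh: "u + h \<in> S" by (auto simp: S_def)
  have B0: "B \<ge> 0" using B[of u] norm_ge_zero[of "f'' u"] by linarith
  have 1: "norm (f' s - f' u) \<le> B * \<bar>h\<bar>" if "s \<in> S" for s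
  proof -
    have "norm (f' s - f' u) \<le> B * norm (s - u)"
    proof (rule differentiable_bound[OF cS _ _ that u])
      show "(f' has_derivative (\<lambda>x. x *\<^sub>R f'' t)) (at t within S)" for t
        using f(2)[of t] has_derivative_at_withinI unfolding has_vector_derivative_def by blast
      show "onorm (\<lambda>x. x *\<^sub>R f'' t) \<le> B" if "t \<in> S" for t
        using that B[of t] by (intro onorm_le) (auto simp: S_def mult.commute[of B] intro!: mult_left_mono)
    qed
    also have "\<dots> \<le> B * \<bar>h\<bar>" using that B0 by (intro mult_left_mono) (auto simp: S_def)
    finally show ?thesis .
  qed
  have "norm (f (u + h) - f u - (u + h - u) *\<^sub>R f' u) \<le> norm (u + h - u) * (B * \<bar>h\<bar>)"
  proof (rule vector_differentiable_bound_linearization[of S])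
    show "closed_segment u (u + h) \<subseteq> S" by (rule closed_segment_subset[OF u uh cS])
  qed (use f(1) 1 u has_vector_derivative_at_within in blast)+
  then show ?thesis by (simp add: scaleR_conv_of_real power2_eq_square mult_ac)
qed

text \<open>Peetre's inequality for the weight of \<open>schwartz_le\<close>.\<close>

lemma one_plus_abs_le_mult: "1 + \<bar>s\<bar> \<le> (1 + \<bar>u\<bar>) * (1 + \<bar>s + u\<bar>)" for s u :: real
proof -
  have "0 \<le> \<bar>u\<bar> * \<bar>s + u\<bar>" by simp
  moreover have "(1 + \<bar>u\<bar>) * (1 + \<bar>s + u\<bar>) = 1 + \<bar>u\<bar> + \<bar>s + u\<bar> + \<bar>u\<bar> * \<bar>s + u\<bar>"
    by (simp add: algebra_simps)
  ultimately show ?thesis by linarith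
qed

section \<open>Convolution\<close>

text \<open>If \<open>T\<close> is given by a function, this is its correlation with
  \<open>f\<close>. It is the inner function of \<open>convolution\<close>.\<close>

definition shift_pairing :: "functional \<Rightarrow> (real \<Rightarrow> complex) \<Rightarrow> real \<Rightarrow> complex" where
  "shift_pairing T f t = T (\<lambda>\<tau>. f (t + \<tau>))"

text \<open>By linearity the error of the difference quotient is \<open>T\<close> of the first-order
  Taylor remainder of \<open>f\<close>. The seminorms of this remainder are of order h^2, so
  continuity of \<open>T\<close> finishes.\<close>

lemma has_vector_derivative_shift_pairing:
  assumes T: "tempered_distribution T" and f: "schwartz f"
  shows "(shift_pairing T f has_vector_derivative shift_pairing T (vderiv f) t) (at t)"
proof -
  obtain C N where C: "C \<ge> 0" "\<And>f A. schwartz f \<Longrightarrow> schwartz_le N f A \<Longrightarrow> norm (T f) \<le> C * A"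
    using tempered_bound[OF T] by blast
  \<comment> \<open>The remainder of a derivative of order up to \<open>N\<close> is controlled by
    derivatives two orders higher.\<close>
  obtain A where A: "schwartz_le (N + 2) f A" using f schwartz_iff by blast
  have sf: "smooth f" using f by (rule schwartz_smooth)
  have sf': "schwartz (vderiv f)" using schwartz_nderiv[OF f, of 1] by simp
  define L where "L = C * (2 ^ N * (1 + \<bar>t\<bar>) ^ N * A)"
  have bound: "norm (shift_pairing T f (t + h) - shift_pairing T f t - h *\<^sub>R shift_pairing T (vderiv f) t)
      \<le> L * h\<^sup>2" if h: "\<bar>h\<bar> \<le> 1" for h
  proof -
    define R where "R = (\<lambda>\<tau>. f ((t + h) + \<tau>) - f (t + \<tau>) - of_real h * vderiv f (t + \<tau>))"
    have s1: "schwartz (\<lambda>\<tau>. f ((t + h) + \<tau>))" "schwartz (\<lambda>\<tau>. f (t + \<tau>))"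
      "schwartz (\<lambda>\<tau>. of_real h * vderiv f (t + \<tau>))"
      by (intro schwartz_cmult schwartz_translate f sf')+
    have sR: "schwartz R" unfolding R_def by (intro schwartz_diff s1)
    have TR: "T R = shift_pairing T f (t + h) - shift_pairing T f t - h *\<^sub>R shift_pairing T (vderiv f) t"
      using s1 schwartz_translate[OF sf', of t]
      by (simp add: R_def tempered_diff[OF T] schwartz_diff tempered_cmult[OF T] shift_pairing_def
          scaleR_conv_of_real)
    have dR: "(vderiv ^^ n) R \<tau> = (vderiv ^^ n) f (t + \<tau> + h) - (vderiv ^^ n) f (t + \<tau>)
        - of_real h * (vderiv ^^ Suc n) f (t + \<tau>)" for n \<tau>
    proof -
      have "R = (\<lambda>\<tau>. f ((t + h) + \<tau>) + ((-1) * f (t + \<tau>) + (- of_real h) * vderiv f (t + \<tau>)))"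
        by (auto simp: R_def)
      then show ?thesis
        by (simp only: nderiv_add nderiv_cmult nderiv_translate smooth_add smooth_cmult
            smooth_translate sf smooth_vderiv nderiv_Suc) (simp add: add_ac)
    qed
    have "schwartz_le N R (h\<^sup>2 * (2 ^ N * (1 + \<bar>t\<bar>) ^ N * A))"
      unfolding schwartz_le_def
    proof (intro allI impI)
      fix n and \<tau> :: real assume n: "n \<le> N"
      define w where "w = (1 + \<bar>\<tau>\<bar>) ^ N"
      have w: "w > 0" by (simp add: w_def add_pos_nonneg)
      \<comment> \<open>Bound for the second derivative near t + tau, in which \<open>w\<close> is
        the weight at tau. Moving the weight from tau to t + tau costs 1 + |t|, and moving on to a
        point at distance at most 1 costs 2.\<close>
      define B where "B = (2 ^ N * (1 + \<bar>t\<bar>) ^ N * A) / w"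
      have "norm ((vderiv ^^ n) R \<tau>) \<le> h\<^sup>2 * B"
        unfolding dR
      proof (rule norm_taylor_le[OF smooth_has_vderiv[OF sf] smooth_has_vderiv[OF sf]])
        fix s assume s: "\<bar>s - (t + \<tau>)\<bar> \<le> \<bar>h\<bar>"
        have "1 + \<bar>\<tau>\<bar> \<le> (1 + \<bar>t\<bar>) * (1 + \<bar>t + \<tau>\<bar>)"
          using one_plus_abs_le_mult[of \<tau> t] by (simp add: add.commute)
        also have "\<dots> \<le> (1 + \<bar>t\<bar>) * (2 * (1 + \<bar>s\<bar>))"
        proof (rule mult_left_mono)
          have "\<bar>t + \<tau>\<bar> \<le> \<bar>s\<bar> + \<bar>s - (t + \<tau>)\<bar>" by linarith
          moreover have "\<bar>s - (t + \<tau>)\<bar> \<le> 1" using s h by (rule order_trans)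
          moreover have "0 \<le> \<bar>s\<bar>" by simp
          ultimately show "1 + \<bar>t + \<tau>\<bar> \<le> 2 * (1 + \<bar>s\<bar>)"
            unfolding distrib_left by linarith
        qed simp
        finally have "w \<le> (2 * (1 + \<bar>t\<bar>) * (1 + \<bar>s\<bar>)) ^ N"
          unfolding w_def by (intro power_mono) (auto simp: algebra_simps)
        then have "w * norm ((vderiv ^^ Suc (Suc n)) f s)
            \<le> (2 * (1 + \<bar>t\<bar>) * (1 + \<bar>s\<bar>)) ^ N * norm ((vderiv ^^ Suc (Suc n)) f s)"
          by (intro mult_right_mono) auto
        also have "\<dots> = 2 ^ N * (1 + \<bar>t\<bar>) ^ N * ((1 + \<bar>s\<bar>) ^ N * norm ((vderiv ^^ Suc (Suc n)) f s))"
          by (simp only: power_mult_distrib mult_ac)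
        also have "\<dots> \<le> 2 ^ N * (1 + \<bar>t\<bar>) ^ N * A"
          using n by (intro mult_left_mono schwartz_leD[OF A]) auto
        finally show "norm ((vderiv ^^ Suc (Suc n)) f s) \<le> B"
          using w by (simp only: B_def pos_le_divide_eq mult.commute)
      qed
      then have "w * norm ((vderiv ^^ n) R \<tau>) \<le> w * (h\<^sup>2 * B)"
        using w by (intro mult_left_mono) auto
      also have "\<dots> = h\<^sup>2 * (2 ^ N * (1 + \<bar>t\<bar>) ^ N * A)" using w by (simp add: B_def)
      finally show "(1 + \<bar>\<tau>\<bar>) ^ N * norm ((vderiv ^^ n) R \<tau>) \<le> h\<^sup>2 * (2 ^ N * (1 + \<bar>t\<bar>) ^ N * A)"
        unfolding w_def .
    qed
    from C(2)[OF sR this] show ?thesis unfolding TR[symmetric] L_def by (simp add: mult_ac)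
  qed
  show ?thesis
    unfolding has_vector_derivative_def has_derivative_at
  proof (intro conjI bounded_linear_scaleR_left)
    show "(\<lambda>h. norm (shift_pairing T f (t + h) - shift_pairing T f t
        - h *\<^sub>R shift_pairing T (vderiv f) t) / norm h) \<midarrow>0\<rightarrow> 0"
    proof (rule Lim_null_comparison)
      have "eventually (\<lambda>h. h \<in> ball (0::real) 1) (at 0)"
        by (intro eventually_at_in_open') auto
      then show "eventually (\<lambda>h. norm (norm (shift_pairing T f (t + h) - shift_pairing T f t
        - h *\<^sub>R shift_pairing T (vderiv f) t) / norm h) \<le> L * \<bar>h\<bar>) (at 0)"
      proof eventually_elim
        case (elim h)
        then have "\<bar>h\<bar> \<le> 1" by (simp add: dist_real_def)
        then have "norm (shift_pairing T f (t + h) - shift_pairing T f t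
            - h *\<^sub>R shift_pairing T (vderiv f) t) / \<bar>h\<bar> \<le> L * h\<^sup>2 / \<bar>h\<bar>"
          by (intro divide_right_mono bound) auto
        also have "L * h\<^sup>2 / \<bar>h\<bar> = L * \<bar>h\<bar>"
          by (simp add: power2_eq_square abs_if)
        finally show ?case by simp
      qed
      have "((\<lambda>h. L * \<bar>h\<bar>) \<longlongrightarrow> L * \<bar>0\<bar>) (at 0)" by (intro tendsto_intros)
      then show "((\<lambda>h. L * \<bar>h\<bar>) \<longlongrightarrow> 0) (at 0)" by simp
    qed
  qed
qed

lemma smooth_shift_pairing:
  assumes T: "tempered_distribution T" and f: "schwartz f"
  shows "smooth (shift_pairing T f)"
proof (rule smooth_coinduct[where X = "{shift_pairing T f | f. schwartz f}"])
  fix g assume "g \<in> {shift_pairing T f | f. schwartz f}"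
  then obtain f where g: "g = shift_pairing T f" "schwartz f" by blast
  have "vderiv g = shift_pairing T (vderiv f)"
    unfolding g(1) by (rule vderivI) (rule has_vector_derivative_shift_pairing[OF T g(2)])
  moreover have "schwartz (vderiv f)" using schwartz_nderiv[OF g(2), of 1] by simp
  moreover have "g differentiable at t" for t
    unfolding g(1) by (rule differentiableI_vector[OF has_vector_derivative_shift_pairing[OF T g(2)]])
  ultimately show "(\<forall>t. g differentiable (at t)) \<and> vderiv g \<in> {shift_pairing T f | f. schwartz f}"
    by blast
qed (use f in blast)

lemma nderiv_shift_pairing:
  assumes T: "tempered_distribution T" and f: "schwartz f"
  shows "(vderiv ^^ n) (shift_pairing T f) = shift_pairing T ((vderiv ^^ n) f)"
proof (induction n)
  case (Suc n)
  have "vderiv (shift_pairing T ((vderiv ^^ n) f)) = shift_pairing T (vderiv ((vderiv ^^ n) f))"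
    by (rule vderivI) (rule has_vector_derivative_shift_pairing[OF T schwartz_nderiv[OF f]])
  then show ?case using Suc by simp
qed simp

text \<open>After a cutoff only tau >= -2 matters. There, and for t >= -2, a large t or a large tau
  forces t + tau to be large, so the weight of \<open>f\<close> at t + tau pays for \<open>N\<close>
  powers in tau and \<open>m\<close> powers in t. \<open>C\<close> is the same for all
  \<open>m\<close>.\<close>

lemma shift_pairing_decay:
  assumes T: "tempered_distribution T" "causal T"
  obtains N C where "C \<ge> 0" "\<And>m f A t. schwartz f \<Longrightarrow> schwartz_le (N + m) f A \<Longrightarrow> t \<ge> -2 \<Longrightarrow>
    (1 + \<bar>t\<bar>) ^ m * norm (shift_pairing T f t) \<le> C * 7 ^ m * A"
proof -
  obtain C N where C: "C \<ge> 0" "\<And>f A. schwartz f \<Longrightarrow> schwartz_le N f A \<Longrightarrow> norm (T f) \<le> C * A"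
    using tempered_bound[OF T(1)] by blast
  obtain K where K: "K \<ge> 0" "\<And>g A. smooth g \<Longrightarrow>
     (\<forall>n\<le>N. \<forall>t\<ge>-2. (1 + \<bar>t\<bar>) ^ N * norm ((vderiv ^^ n) g t) \<le> A) \<Longrightarrow>
     schwartz_le N (\<lambda>t. cutoff t * g t) (K * A)"
    using schwartz_le_cutoff_mult[of N] by blast
  have "(1 + \<bar>t\<bar>) ^ m * norm (shift_pairing T f t) \<le> (C * K * 7 ^ N) * 7 ^ m * A"
    if f: "schwartz f" "schwartz_le (N + m) f A" "t \<ge> -2" for m f A t
  proof -
    define w where "w = (1 + \<bar>t\<bar>) ^ m"
    have w: "w > 0" by (simp add: w_def add_pos_nonneg)
    have sf: "smooth f" using f(1) by (rule schwartz_smooth)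
    have st: "schwartz (\<lambda>\<tau>. f (t + \<tau>))" by (rule schwartz_translate[OF f(1)])
    have *: "(1 + \<bar>\<tau>\<bar>) ^ N * norm ((vderiv ^^ n) (\<lambda>\<tau>. f (t + \<tau>)) \<tau>) \<le> 7 ^ N * 7 ^ m * A / w"
      if "n \<le> N" "\<tau> \<ge> -2" for n \<tau>
    proof -
      \<comment> \<open>If t and tau are at least -2, each of them is at most |t + tau| + 2. The
        constant 7 is generous.\<close>
      have 7: "1 + \<bar>\<tau>\<bar> \<le> 7 * (1 + \<bar>t + \<tau>\<bar>)" "1 + \<bar>t\<bar> \<le> 7 * (1 + \<bar>t + \<tau>\<bar>)"
        using that(2) f(3) by (simp_all add: abs_if)
      have "w * (1 + \<bar>\<tau>\<bar>) ^ N \<le> (7 * (1 + \<bar>t + \<tau>\<bar>)) ^ m * (7 * (1 + \<bar>t + \<tau>\<bar>)) ^ N"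
        unfolding w_def using 7 by (intro mult_mono power_mono) auto
      also have "\<dots> = 7 ^ N * 7 ^ m * (1 + \<bar>t + \<tau>\<bar>) ^ (N + m)"
        by (simp only: power_mult_distrib power_add mult_ac)
      finally have "w * (1 + \<bar>\<tau>\<bar>) ^ N * norm ((vderiv ^^ n) f (t + \<tau>))
          \<le> 7 ^ N * 7 ^ m * (1 + \<bar>t + \<tau>\<bar>) ^ (N + m) * norm ((vderiv ^^ n) f (t + \<tau>))"
        by (intro mult_right_mono) auto
      also have "\<dots> \<le> 7 ^ N * 7 ^ m * A"
        unfolding mult.assoc[of _ "(1 + \<bar>t + \<tau>\<bar>) ^ (N + m)"]
        using that(1) by (intro mult_left_mono schwartz_leD[OF f(2)]) auto
      finally show ?thesis
        using w unfolding nderiv_translate[OF sf] by (simp only: pos_le_divide_eq mult_ac)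
    qed
    have le: "schwartz_le N (\<lambda>\<tau>. cutoff \<tau> * f (t + \<tau>)) (K * (7 ^ N * 7 ^ m * A / w))"
      using * by (intro K(2) smooth_translate sf) blast
    have sc: "schwartz (\<lambda>\<tau>. cutoff \<tau> * f (t + \<tau>))"
      unfolding schwartz_iff
    proof (intro conjI allI smooth_mult smooth_cutoff smooth_translate sf)
      fix M
      obtain K where K: "\<And>g A. smooth g \<Longrightarrow>
         (\<forall>n\<le>M. \<forall>t\<ge>-2. (1 + \<bar>t\<bar>) ^ M * norm ((vderiv ^^ n) g t) \<le> A) \<Longrightarrow>
         schwartz_le M (\<lambda>t. cutoff t * g t) (K * A)"
        using schwartz_le_cutoff_mult[of M] by blast
      obtain A where "schwartz_le M (\<lambda>\<tau>. f (t + \<tau>)) A" using st schwartz_iff by blast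
      then have "schwartz_le M (\<lambda>\<tau>. cutoff \<tau> * f (t + \<tau>)) (K * A)"
        unfolding schwartz_le_def[of _ "\<lambda>\<tau>. f (t + \<tau>)"]
        by (intro K smooth_translate sf) blast
      then show "\<exists>A. schwartz_le M (\<lambda>\<tau>. cutoff \<tau> * f (t + \<tau>)) A" ..
    qed
    \<comment> \<open>Causality enters here: \<open>T\<close> does not see the cutoff, which leaves
      only the range of tau covered by the estimate above.\<close>
    have "shift_pairing T f t = T (\<lambda>\<tau>. cutoff \<tau> * f (t + \<tau>))"
      unfolding shift_pairing_def
      by (rule causal_cong[OF T st sc, of 1]) (auto simp: cutoff_1)
    then have "norm (shift_pairing T f t) \<le> C * (K * (7 ^ N * 7 ^ m * A / w))"
      using C(2)[OF sc le] by simp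
    then have "w * norm (shift_pairing T f t) \<le> w * (C * (K * (7 ^ N * 7 ^ m * A / w)))"
      using w by (intro mult_left_mono) auto
    also have "\<dots> = (C * K * 7 ^ N) * 7 ^ m * A" using w by simp
    finally show ?thesis unfolding w_def .
  qed
  then show ?thesis by (intro that[of "C * K * 7 ^ N" N]) (use C K in auto)
qed

text \<open>Continuity of the passage from \<open>f\<close> to the argument of the outer functional:
  \<open>N\<close> and \<open>C\<close> are obtained before \<open>f\<close>.\<close>

lemma schwartz_le_cutoff_shift_pairing:
  assumes T: "tempered_distribution T" "causal T"
  obtains N C where "\<And>f A. schwartz f \<Longrightarrow> schwartz_le N f A \<Longrightarrow>
    schwartz_le M (\<lambda>t. cutoff t * shift_pairing T f t) (C * A)"
proof -
  obtain N C where C: "C \<ge> 0" "\<And>m f A t. schwartz f \<Longrightarrow> schwartz_le (N + m) f A \<Longrightarrow> t \<ge> -2 \<Longrightarrow>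
    (1 + \<bar>t\<bar>) ^ m * norm (shift_pairing T f t) \<le> C * 7 ^ m * A"
    by (rule shift_pairing_decay[OF T]) (rule that; assumption)
  obtain K where K: "\<And>g A. smooth g \<Longrightarrow>
     (\<forall>n\<le>M. \<forall>t\<ge>-2. (1 + \<bar>t\<bar>) ^ M * norm ((vderiv ^^ n) g t) \<le> A) \<Longrightarrow>
     schwartz_le M (\<lambda>t. cutoff t * g t) (K * A)"
    using schwartz_le_cutoff_mult[of M] by blast
  \<comment> \<open>Of the order N + M + M, \<open>N\<close> is consumed by \<open>T\<close>, one
    \<open>M\<close> by the derivatives in t and the other \<open>M\<close> by the powers of
    t.\<close>
  have "schwartz_le M (\<lambda>t. cutoff t * shift_pairing T f t) (K * (C * 7 ^ M * A))"
    if f: "schwartz f" "schwartz_le (N + M + M) f A" for f A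
  proof (intro K smooth_shift_pairing T f allI impI)
    fix n and t :: real assume nt: "n \<le> M" "t \<ge> -2"
    have "schwartz_le (N + M) ((vderiv ^^ n) f) A"
      using nt(1) by (intro schwartz_le_nderiv schwartz_le_mono[OF f(2)]) auto
    then show "(1 + \<bar>t\<bar>) ^ M * norm ((vderiv ^^ n) (shift_pairing T f) t) \<le> C * 7 ^ M * A"
      unfolding nderiv_shift_pairing[OF T(1) f(1)]
      using nt(2) by (intro C schwartz_nderiv f)
  qed
  then show ?thesis by (intro that[of "N + M + M" "K * C * 7 ^ M"]) (simp add: mult.assoc)
qed

lemma schwartz_cutoff_shift_pairing:
  assumes T: "tempered_distribution T" "causal T" and f: "schwartz f"
  shows "schwartz (\<lambda>t. cutoff t * shift_pairing T f t)"
  unfolding schwartz_iff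
proof (intro conjI allI smooth_mult smooth_cutoff smooth_shift_pairing T f)
  fix M
  obtain N C where "\<And>f A. schwartz f \<Longrightarrow> schwartz_le N f A \<Longrightarrow>
    schwartz_le M (\<lambda>t. cutoff t * shift_pairing T f t) (C * A)"
    using schwartz_le_cutoff_shift_pairing[OF T] by blast
  then show "\<exists>A. schwartz_le M (\<lambda>t. cutoff t * shift_pairing T f t) A"
    using f schwartz_iff by blast
qed

lemma convolution_eq:
  assumes S: "tempered_distribution S" "causal S" and T: "tempered_distribution T" "causal T"
    and f: "schwartz f"
  shows "convolution S T f = S (\<lambda>t. cutoff t * shift_pairing T f t)"
  unfolding convolution_def
  by (rule causal_pairing_eq[OF S schwartz_cutoff_shift_pairing[OF T f], of 1])
    (auto simp: cutoff_1 shift_pairing_def)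

lemma tempered_convolution:
  assumes S: "tempered_distribution S" "causal S" and T: "tempered_distribution T" "causal T"
  shows "tempered_distribution (convolution S T)"
  unfolding tempered_distribution_def
proof (intro conjI allI impI)
  fix f g assume fg: "schwartz f" "schwartz g"
  have "shift_pairing T (\<lambda>t. f t + g t) t = shift_pairing T f t + shift_pairing T g t" for t
    unfolding shift_pairing_def by (intro tempered_add T schwartz_translate fg)
  then show "convolution S T (\<lambda>t. f t + g t) = convolution S T f + convolution S T g"
    using fg by (simp add: convolution_eq[OF S T] schwartz_add distrib_left
        tempered_add[OF S(1)] schwartz_cutoff_shift_pairing[OF T])
next
  fix c f assume f: "schwartz f"
  have "shift_pairing T (\<lambda>t. c * f t) t = c * shift_pairing T f t" for t
    unfolding shift_pairing_def by (intro tempered_cmult T schwartz_translate f)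
  then have "(\<lambda>t. cutoff t * shift_pairing T (\<lambda>t. c * f t) t) = (\<lambda>t. c * (cutoff t * shift_pairing T f t))"
    by (simp only: mult.left_commute)
  then show "convolution S T (\<lambda>t. c * f t) = c * convolution S T f"
    by (simp only: convolution_eq[OF S T] schwartz_cmult f
        tempered_cmult[OF S(1)] schwartz_cutoff_shift_pairing[OF T])
next
  \<comment> \<open>The order \<open>M\<close> of \<open>S\<close> comes first; the order
    \<open>N\<close> demanded of \<open>f\<close> is then chosen so as to control the inner function
    at order \<open>M\<close>.\<close>
  obtain C M where C: "C \<ge> 0" "\<And>f A. schwartz f \<Longrightarrow> schwartz_le M f A \<Longrightarrow> norm (S f) \<le> C * A"
    using tempered_bound[OF S(1)] by blast
  obtain N D where D: "\<And>f A. schwartz f \<Longrightarrow> schwartz_le N f A \<Longrightarrow>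
    schwartz_le M (\<lambda>t. cutoff t * shift_pairing T f t) (D * A)"
    using schwartz_le_cutoff_shift_pairing[OF T] by blast
  have "norm (convolution S T f) \<le> (C * (D * 2 ^ Suc N)) * (\<Sum>k\<le>N. \<Sum>n\<le>N. schwartz_seminorm k n f)"
    if f: "schwartz f" for f
    using C(2)[OF schwartz_cutoff_shift_pairing[OF T f] D[OF f schwartz_le_seminorms[OF f]]]
    by (simp add: convolution_eq[OF S T f] mult.assoc)
  then show "\<exists>C N. \<forall>f. schwartz f \<longrightarrow>
      norm (convolution S T f) \<le> C * (\<Sum>k\<le>N. \<Sum>n\<le>N. schwartz_seminorm k n f)"
    by blast
qed

text \<open>The closed support of \<open>f\<close> misses 0, so \<open>f\<close> vanishes to the
  right of some -e. Splitting e into two halves, the inner pairing vanishes for t > -e/2, and then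
  so does the outer one.\<close>

lemma causal_convolution:
  assumes S: "tempered_distribution S" "causal S" and T: "tempered_distribution T" "causal T"
  shows "causal (convolution S T)"
  unfolding causal_def supported_in_def
proof (intro allI impI)
  fix f assume f: "test_function f" "closure {t. f t \<noteq> 0} \<inter> {0..} = {}"
  have sf: "schwartz f" using f(1) by (rule schwartz_test_function)
  have "0 \<in> - closure {t. f t \<noteq> 0}" using f(2) by auto
  then obtain e where e: "e > 0" "ball 0 e \<subseteq> - closure {t. f t \<noteq> 0}"
    using openE[OF open_Compl[OF closed_closure]] by blast
  have f0: "f t = 0" if "t > - e" for t
  proof -
    have "t \<notin> closure {t. f t \<noteq> 0}"
    proof (cases "t \<ge> 0")
      case False
      then have "t \<in> ball 0 e" using that by simp
      then show ?thesis using e(2) by blast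
    qed (use f(2) in auto)
    then show ?thesis using subsetD[OF closure_subset, of t "{t. f t \<noteq> 0}"] by blast
  qed
  have "shift_pairing T f t = 0" if "t > - (e / 2)" for t
    unfolding shift_pairing_def
    by (rule causal_zero[OF T schwartz_translate[OF sf], of "e / 2"]) (use e that f0 in auto)
  then show "convolution S T f = 0"
    unfolding convolution_eq[OF S T sf]
    by (intro causal_zero[OF S schwartz_cutoff_shift_pairing[OF T sf], of "e / 2"]) (use e in auto)
qed

section \<open>Exponentials as test functions and the convolution theorem\<close>

lemma has_vector_derivative_exp_ii:
  "((\<lambda>t. exp (\<i> * \<omega> * of_real t)) has_vector_derivative \<i> * \<omega> * exp (\<i> * \<omega> * of_real t)) (at t)"
proof -
  have "((\<lambda>z. exp (\<i> * \<omega> * z)) has_field_derivative \<i> * \<omega> * exp (\<i> * \<omega> * of_real t)) (at (of_real t))"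
    by (auto intro!: derivative_eq_intros)
  then show ?thesis by (rule has_vector_derivative_real_field)
qed

lemma smooth_exp_ii: "smooth (\<lambda>t. exp (\<i> * \<omega> * of_real t))"
  and nderiv_exp_ii: "(vderiv ^^ n) (\<lambda>t. exp (\<i> * \<omega> * of_real t)) =
    (\<lambda>t. (\<i> * \<omega>) ^ n * exp (\<i> * \<omega> * of_real t))"
proof -
  have d: "((\<lambda>t. c * exp (\<i> * \<omega> * of_real t)) has_vector_derivative
      c * (\<i> * \<omega>) * exp (\<i> * \<omega> * of_real t)) (at t)" for c t
    using has_vector_derivative_mult_right[OF has_vector_derivative_exp_ii[of \<omega> t], of c]
    by (simp add: mult.assoc)
  have n: "(vderiv ^^ n) (\<lambda>t. exp (\<i> * \<omega> * of_real t)) =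
    (\<lambda>t. (\<i> * \<omega>) ^ n * exp (\<i> * \<omega> * of_real t))" for n
  proof (induction n)
    case (Suc n)
    show ?case using vderivI[OF d[of "(\<i> * \<omega>) ^ n"]] Suc by (simp add: mult_ac)
  qed simp
  show "smooth (\<lambda>t. exp (\<i> * \<omega> * of_real t))"
    unfolding smooth_def n using d differentiableI_vector by blast
  show "(vderiv ^^ n) (\<lambda>t. exp (\<i> * \<omega> * of_real t)) =
    (\<lambda>t. (\<i> * \<omega>) ^ n * exp (\<i> * \<omega> * of_real t))" by (rule n)
qed

lemma power_exp_bounded:
  assumes "b > (0::real)"
  obtains A where "\<And>t. t \<ge> -2 \<Longrightarrow> (1 + \<bar>t\<bar>) ^ M * exp (- b * t) \<le> A"
proof -
  have "(1 + \<bar>t\<bar>) ^ M * exp (- b * t) \<le> (5 + M / b) ^ M * exp (2 * b)" if t: "t \<ge> -2" for t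
  proof (cases "M = 0")
    case True
    then show ?thesis using mult_left_mono[OF t, of b] assms by simp
  next
    case False
    \<comment> \<open>The elementary bound 1 + x <= exp x at x = c (t + 2) controls 1 + |t|; its
      M-th power has the exponent b (t + 2). The shift by 2 keeps x nonnegative on the range of
      t.\<close>
    define c where "c = b / M"
    have c: "c > 0" using assms False by (simp add: c_def)
    have "1 + c * (t + 2) \<le> exp (c * (t + 2))" by (rule exp_ge_add_one_self)
    then have e: "c * (t + 2) \<le> exp (c * (t + 2))" by linarith
    have "t + 2 \<le> exp (c * (t + 2)) / c" using e c by (simp add: field_simps)
    moreover have "1 \<le> exp (c * (t + 2))" using c t by simp
    moreover have "1 + \<bar>t\<bar> \<le> 5 + (t + 2)" using t by linarith
    ultimately have "1 + \<bar>t\<bar> \<le> 5 * exp (c * (t + 2)) + exp (c * (t + 2)) / c" by linarith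
    also have "\<dots> = (5 + M / b) * exp (c * (t + 2))"
      using False assms by (simp add: c_def field_simps)
    finally have "(1 + \<bar>t\<bar>) ^ M \<le> ((5 + M / b) * exp (c * (t + 2))) ^ M"
      by (intro power_mono) auto
    also have "\<dots> = (5 + M / b) ^ M * exp (b * (t + 2))"
      using False by (simp add: power_mult_distrib c_def flip: exp_of_nat_mult)
    finally have "(1 + \<bar>t\<bar>) ^ M * exp (- b * t) \<le> (5 + M / b) ^ M * exp (b * (t + 2)) * exp (- b * t)"
      by (intro mult_right_mono) auto
    moreover have "exp (b * (t + 2)) * exp (- b * t) = exp (2 * b)"
      by (simp add: algebra_simps flip: exp_add)
    ultimately show ?thesis by (simp only: mult.assoc)
  qed
  then show ?thesis using that by blast
qed

lemma schwartz_cutoff_exp_ii: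
  assumes "Im \<omega> > 0"
  shows "schwartz (\<lambda>t. cutoff t * exp (\<i> * \<omega> * of_real t))"
  unfolding schwartz_iff
proof (intro conjI allI smooth_mult smooth_cutoff smooth_exp_ii)
  fix M
  obtain K where K: "\<And>g A. smooth g \<Longrightarrow>
     (\<forall>n\<le>M. \<forall>t\<ge>-2. (1 + \<bar>t\<bar>) ^ M * norm ((vderiv ^^ n) g t) \<le> A) \<Longrightarrow>
     schwartz_le M (\<lambda>t. cutoff t * g t) (K * A)"
    using schwartz_le_cutoff_mult[of M] by blast
  obtain A where A: "\<And>t. t \<ge> -2 \<Longrightarrow> (1 + \<bar>t\<bar>) ^ M * exp (- Im \<omega> * t) \<le> A"
    using power_exp_bounded[OF assms] by blast
  have "schwartz_le M (\<lambda>t. cutoff t * exp (\<i> * \<omega> * of_real t)) (K * ((1 + norm \<omega>) ^ M * A))"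
  proof (intro K smooth_exp_ii allI impI)
    fix n and t :: real assume nt: "n \<le> M" "t \<ge> -2"
    have "norm \<omega> ^ n \<le> (1 + norm \<omega>) ^ n" by (intro power_mono) auto
    also have "\<dots> \<le> (1 + norm \<omega>) ^ M" using nt by (intro power_increasing) auto
    finally have "norm \<omega> ^ n * ((1 + \<bar>t\<bar>) ^ M * exp (- Im \<omega> * t)) \<le> (1 + norm \<omega>) ^ M * A"
      using A[OF nt(2)] by (intro mult_mono) auto
    then show "(1 + \<bar>t\<bar>) ^ M * norm ((vderiv ^^ n) (\<lambda>t. exp (\<i> * \<omega> * of_real t)) t)
        \<le> (1 + norm \<omega>) ^ M * A"
      by (simp only: nderiv_exp_ii norm_mult norm_power) (simp add: mult_ac)
  qed
  then show "\<exists>A. schwartz_le M (\<lambda>t. cutoff t * exp (\<i> * \<omega> * of_real t)) A" ..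
qed

lemma fourier_eq:
  assumes T: "tempered_distribution T" "causal T" and \<omega>: "Im \<omega> > 0"
  shows "fourier T \<omega> = T (\<lambda>t. cutoff t * exp (\<i> * \<omega> * of_real t))"
  unfolding fourier_def
  by (rule causal_pairing_eq[OF T schwartz_cutoff_exp_ii[OF \<omega>], of 1]) (auto simp: cutoff_1)

lemma fourier_convolution:
  assumes S: "tempered_distribution S" "causal S" and T: "tempered_distribution T" "causal T"
    and \<omega>: "Im \<omega> > 0"
  shows "fourier (convolution S T) \<omega> = fourier S \<omega> * fourier T \<omega>"
proof -
  define e where "e = (\<lambda>t::real. exp (\<i> * \<omega> * of_real t))"
  define g where "g = (\<lambda>t. cutoff t * e t)"
  have sg: "schwartz g" unfolding g_def e_def by (rule schwartz_cutoff_exp_ii[OF \<omega>])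
  have FS: "fourier S \<omega> = S g" and FT: "fourier T \<omega> = T g"
    unfolding g_def e_def by (intro fourier_eq S T \<omega>)+
  have e_add: "e (t + s) = e t * e s" for t s by (simp add: e_def algebra_simps flip: exp_add)
  \<comment> \<open>The exponential is a character, so it is an eigenfunction of the shift. If t and
    tau both exceed -1/2, then t + tau > -1, where the cutoff is 1.\<close>
  have "shift_pairing T g t = e t * T g" if t: "t > - (1 / 2)" for t
  proof -
    have "T (\<lambda>\<tau>. g (t + \<tau>)) = T (\<lambda>\<tau>. e t * g \<tau>)"
      by (rule causal_cong[OF T schwartz_translate[OF sg] schwartz_cmult[OF sg], of "1 / 2"])
        (use t in \<open>auto simp: g_def cutoff_1 e_add\<close>)
    then show ?thesis by (simp add: shift_pairing_def tempered_cmult[OF T(1) sg])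
  qed
  then have "S (\<lambda>t. cutoff t * shift_pairing T g t) = S (\<lambda>t. T g * g t)"
    by (intro causal_cong[OF S schwartz_cutoff_shift_pairing[OF T sg] schwartz_cmult[OF sg], of "1 / 2"])
      (auto simp: g_def)
  then have "convolution S T g = T g * S g"
    by (simp add: convolution_eq[OF S T sg] tempered_cmult[OF S(1) sg])
  moreover have "fourier (convolution S T) \<omega> = convolution S T g"
    unfolding g_def e_def
    by (intro fourier_eq tempered_convolution causal_convolution S T \<omega>)
  ultimately show ?thesis by (simp add: FS FT)
qed

section \<open>Holomorphic parameter integrals\<close>

text \<open>Cauchy's inequality on circles of radius r/4. Around points within r/2 of
  \<open>z\<close> these stay within 3r/4, hence inside the ball where \<open>B\<close> is a
  bound.\<close>

lemma norm_deriv_le_dominated: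
  assumes "f holomorphic_on ball z r" "r > 0" and B: "\<And>w. w \<in> ball z r \<Longrightarrow> norm (f w) \<le> B"
    and w: "w \<in> ball z (r / 2)"
  shows "norm (deriv f w) \<le> B / (r / 4)"
proof -
  have sub: "cball w (r / 4) \<subseteq> ball z r"
  proof
    fix y assume "y \<in> cball w (r / 4)"
    then have "dist z y \<le> dist z w + r / 4" using dist_triangle[of z y w] by simp
    then show "y \<in> ball z r" using w assms(2) by simp
  qed
  have "norm ((deriv ^^ 1) f w) \<le> fact 1 * B / (r / 4) ^ 1"
  proof (rule Cauchy_inequality)
    show "f holomorphic_on ball w (r / 4)"
      using assms(1) by (rule holomorphic_on_subset) (use sub ball_subset_cball in blast)
    show "continuous_on (cball w (r / 4)) f"
      using holomorphic_on_imp_continuous_on[OF assms(1)] sub by (rule continuous_on_subset)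
    show "norm (f x) \<le> B" if "norm (w - x) = r / 4" for x
      using B sub that by (auto simp: dist_norm subset_iff)
  qed (use assms in auto)
  then show ?thesis by simp
qed

text \<open>Only the integrand has to be dominated: for holomorphic functions Cauchy's inequality
  turns this into domination of the difference quotients, and dominated convergence differentiates
  under the integral.\<close>

lemma holomorphic_on_integral:
  fixes f :: "complex \<Rightarrow> 'a \<Rightarrow> complex"
  assumes S: "open S"
    and hol: "\<And>t. t \<in> space M \<Longrightarrow> (\<lambda>z. f z t) holomorphic_on S"
    and meas: "\<And>z. z \<in> S \<Longrightarrow> f z \<in> borel_measurable M"
    and dom: "\<And>z. z \<in> S \<Longrightarrow> \<exists>r>0. \<exists>g. integrable M g \<and>
      (\<forall>w\<in>ball z r \<inter> S. \<forall>t\<in>space M. norm (f w t) \<le> g t)"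
  shows "(\<lambda>z. \<integral>t. f z t \<partial>M) holomorphic_on S"
  unfolding holomorphic_on_open[OF S]
proof
  fix z assume z: "z \<in> S"
  obtain r0 g where r0: "r0 > 0" and g: "integrable M g"
    and bd0: "\<And>w t. w \<in> ball z r0 \<inter> S \<Longrightarrow> t \<in> space M \<Longrightarrow> norm (f w t) \<le> g t"
    using dom[OF z] by blast
  obtain r1 where r1: "r1 > 0" "ball z r1 \<subseteq> S" using S z openE by blast
  define r where "r = min r0 r1"
  have r: "r > 0" using r0 r1 by (simp add: r_def)
  have rS: "ball z r \<subseteq> S" using r1(2) by (auto simp: r_def)
  have bd: "norm (f w t) \<le> g t" if "w \<in> ball z r" "t \<in> space M" for w t
    using that rS by (intro bd0) (auto simp: r_def)
  have int: "integrable M (f w)" if "w \<in> ball z r" for w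
    using that rS by (intro Bochner_Integration.integrable_bound[OF g])
      (auto intro!: meas order_trans[OF bd])
  \<comment> \<open>The ball is convex, so the bound on the derivative is a Lipschitz constant,
    integrable in t.\<close>
  have lip: "norm (f w t - f z t) \<le> g t / (r / 4) * norm (w - z)"
    if w: "w \<in> ball z (r / 2)" and t: "t \<in> space M" for w t
  proof (rule field_differentiable_bound[of "ball z (r / 2)" "\<lambda>z. f z t" "deriv (\<lambda>z. f z t)"])
    fix y assume y: "y \<in> ball z (r / 2)"
    then have "y \<in> S" using rS r by (auto simp: subset_iff)
    then show "((\<lambda>z. f z t) has_field_derivative deriv (\<lambda>z. f z t) y) (at y within ball z (r / 2))"
      using holomorphic_derivI[OF hol[OF t] S] has_field_derivative_at_within by blast
    show "norm (deriv (\<lambda>z. f z t) y) \<le> g t / (r / 4)"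
      by (rule norm_deriv_le_dominated[OF holomorphic_on_subset[OF hol[OF t] rS] r bd[OF _ t] y])
  qed (use w r in auto)
  define D where "D = (\<lambda>t. deriv (\<lambda>z. f z t) z)"
  have "((\<lambda>z. \<integral>t. f z t \<partial>M) has_field_derivative (\<integral>t. D t \<partial>M)) (at z)"
  proof -
    have "((\<lambda>w. ((\<integral>t. f w t \<partial>M) - (\<integral>t. f z t \<partial>M)) / (w - z)) \<longlongrightarrow> (\<integral>t. D t \<partial>M))
        (at z within ball z (r / 2))"
      unfolding tendsto_at_iff_sequentially comp_def
    proof (intro allI impI)
      fix X :: "nat \<Rightarrow> complex" assume X: "\<forall>i. X i \<in> ball z (r / 2) - {z}" and Xz: "X \<longlonglongrightarrow> z"
      have XS: "X i \<in> ball z (r / 2)" "X i \<noteq> z" for i using X by auto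
      moreover have "ball z (r / 2) \<subseteq> ball z r" using r by (intro subset_ball) simp
      ultimately have XS: "X i \<in> ball z (r / 2)" "X i \<noteq> z" "X i \<in> ball z r" for i by blast+
      have zr: "z \<in> ball z r" using r by simp
      have Xz': "filterlim X (at z) sequentially"
        using Xz XS by (simp add: filterlim_at)
      have lim: "(\<lambda>i. (f (X i) t - f z t) / (X i - z)) \<longlonglongrightarrow> D t" if t: "t \<in> space M" for t
      proof -
        have "((\<lambda>z. f z t) has_field_derivative D t) (at z)"
          unfolding D_def using holomorphic_derivI[OF hol[OF t] S z] .
        then show ?thesis
          unfolding has_field_derivative_iff using filterlim_compose Xz' by blast
      qed
      have m: "(\<lambda>t. (f (X i) t - f z t) / (X i - z)) \<in> borel_measurable M" for i
        using meas[of "X i"] meas[OF z] XS(3)[of i] rS by (intro borel_measurable_divide borel_measurable_diff) auto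
      have "(\<lambda>i. \<integral>t. (f (X i) t - f z t) / (X i - z) \<partial>M) \<longlonglongrightarrow> (\<integral>t. D t \<partial>M)"
      proof (rule integral_dominated_convergence)
        show "D \<in> borel_measurable M" by (rule borel_measurable_LIMSEQ_metric[OF m lim])
        show "integrable M (\<lambda>t. g t / (r / 4))" using g by simp
        show "AE t in M. (\<lambda>i. (f (X i) t - f z t) / (X i - z)) \<longlonglongrightarrow> D t"
          using lim by (rule AE_I2)
        show "AE t in M. norm ((f (X i) t - f z t) / (X i - z)) \<le> g t / (r / 4)" for i
        proof (rule AE_I2)
          fix t assume t: "t \<in> space M"
          have "norm (X i - z) > 0" using XS(2) by simp
          then show "norm ((f (X i) t - f z t) / (X i - z)) \<le> g t / (r / 4)"
            using lip[OF XS(1) t, of i] by (simp only: norm_divide pos_divide_le_eq)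
        qed
      qed (rule m)
      moreover have "(\<integral>t. (f (X i) t - f z t) / (X i - z) \<partial>M)
          = ((\<integral>t. f (X i) t \<partial>M) - (\<integral>t. f z t \<partial>M)) / (X i - z)" for i
        using int[OF XS(3)[of i]] int[OF zr] by simp
      ultimately show "(\<lambda>i. ((\<integral>t. f (X i) t \<partial>M) - (\<integral>t. f z t \<partial>M)) / (X i - z)) \<longlonglongrightarrow> (\<integral>t. D t \<partial>M)"
        by (simp only:)
    qed
    moreover have "at z within ball z (r / 2) = at z" using r by (intro at_within_open) auto
    ultimately show ?thesis unfolding has_field_derivative_iff by simp
  qed
  then show "\<exists>f'. ((\<lambda>z. \<integral>t. f z t \<partial>M) has_field_derivative f') (at z)" ..
qed

abbreviation right_half_plane :: "complex set" where
  "right_half_plane \<equiv> {p. Re p > 0}"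

lemma open_right_half_plane: "open right_half_plane"
  by (rule open_halfspace_Re_gt)

lemma beta_holomorphic:
  assumes \<nu>: "sets \<nu> = sets (restrict_space borel {0<..})"
    and fin: "(\<integral>\<^sup>+r. ennreal (1 / (1 + r)) \<partial>\<nu>) < \<infinity>"
  shows "beta \<nu> holomorphic_on right_half_plane"
proof -
  have sp: "space \<nu> = {0<..}" using sets_eq_imp_space_eq[OF \<nu>] by (simp add: space_restrict_space)
  have meas: "f \<in> borel_measurable \<nu>" if "f \<in> borel_measurable borel" for f :: "real \<Rightarrow> 'b::topological_space"
    using that measurable_restrict_space1 measurable_cong_sets[OF \<nu> refl] by blast
  have int: "integrable \<nu> (\<lambda>r. 1 / (1 + r))"
    using fin by (intro integrableI_nonneg meas) (auto simp: sp intro!: AE_I2)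
  have "(\<lambda>p. \<integral>r. 1 / (p + of_real r) \<partial>\<nu>) holomorphic_on right_half_plane"
  proof (rule holomorphic_on_integral[OF open_right_half_plane])
    fix r assume "r \<in> space \<nu>"
    then show "(\<lambda>p. 1 / (p + of_real r)) holomorphic_on right_half_plane"
      by (intro holomorphic_intros) (auto simp: sp complex_eq_iff)
  next
    fix p :: complex
    show "(\<lambda>r. 1 / (p + of_real r)) \<in> borel_measurable \<nu>"
      by (rule meas) measurable
  next
    fix p assume p: "p \<in> right_half_plane"
    \<comment> \<open>Within distance c of p the real part stays above c, and c <= 1, so Re w + r is
      at least c (1 + r). This reduces domination to the integrability condition on
      \<open>\<nu>\<close>.\<close>
    define c where "c = min 1 (Re p / 2)"
    have c: "c > 0" "c \<le> 1" "c \<le> Re p / 2" using p by (auto simp: c_def)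
    show "\<exists>d>0. \<exists>g. integrable \<nu> g \<and>
        (\<forall>w\<in>ball p d \<inter> right_half_plane. \<forall>r\<in>space \<nu>. norm (1 / (w + of_real r)) \<le> g r)"
    proof (intro exI[of _ c] exI[of _ "\<lambda>r. (1 / c) * (1 / (1 + r))"] conjI ballI c)
      show "integrable \<nu> (\<lambda>r. (1 / c) * (1 / (1 + r)))"
        by (intro integrable_mult_right int)
      fix w r assume w: "w \<in> ball p c \<inter> right_half_plane" and r: "r \<in> space \<nu>"
      have "Re p - Re w < c" using w complex_Re_le_cmod[of "p - w"] by (simp add: dist_norm)
      then have "c * (1 + r) \<le> Re w + r"
      proof -
        have "c * r \<le> r" using c r by (intro mult_left_le_one_le) (auto simp: sp)
        then show ?thesis using \<open>Re p - Re w < c\<close> c unfolding distrib_left mult_1_right by linarith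
      qed
      also have "\<dots> \<le> norm (w + of_real r)" using complex_Re_le_cmod[of "w + of_real r"] by simp
      finally have le: "c * (1 + r) \<le> norm (w + of_real r)" .
      have "0 < c * (1 + r)" using c r by (simp add: sp)
      then show "norm (1 / (w + of_real r)) \<le> (1 / c) * (1 / (1 + r))"
        using le by (simp add: norm_divide frac_le)
    qed
  qed
  then show ?thesis
    unfolding beta_def[abs_def] by (intro holomorphic_on_mult holomorphic_on_ident)
qed

section \<open>Relaxation moduli\<close>

locale relaxation_modulus =
  fixes G :: "real \<Rightarrow> real"
  assumes cm: "completely_monotonic G" and loc_int: "locally_integrable G"
begin

lemma cmD:
  assumes "t > 0"
  shows "(deriv ^^ n) G differentiable (at t)" "(-1) ^ n * (deriv ^^ n) G t \<ge> 0"
  using cm assms unfolding completely_monotonic_def by blast+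

lemma G_has_deriv: "t > 0 \<Longrightarrow> (G has_real_derivative deriv G t) (at t)"
  using cmD(1)[of t 0] by (simp add: DERIV_deriv_iff_real_differentiable)

lemma G_nonneg: "t > 0 \<Longrightarrow> G t \<ge> 0"
  using cmD(2)[of t 0] by simp

lemma deriv_G_nonpos: "t > 0 \<Longrightarrow> deriv G t \<le> 0"
  using cmD(2)[of t 1] by simp

lemma G_antimono: "0 < s \<Longrightarrow> s \<le> t \<Longrightarrow> G t \<le> G s"
  using DERIV_nonpos_imp_nonincreasing[of s t G] G_has_deriv deriv_G_nonpos
  by (metis order_less_le_trans)

lemma continuous_on_G: "continuous_on {0<..} G"
  by (intro continuous_at_imp_continuous_on ballI DERIV_isCont[OF G_has_deriv]) auto

text \<open>\<open>Lim\<close> is informative only once convergence is known; here monotonicity and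
  the bound 0 make \<open>G\<close> converge to its infimum.\<close>

lemma G_infinity_le:
  assumes "t > 0"
  shows "G_infinity G \<le> G t"
proof -
  define L where "L = (INF t\<in>{0<..}. G t)"
  have bdd: "bdd_below (G ` {0<..})" using G_nonneg by (intro bdd_belowI[of _ 0]) auto
  have L: "L \<le> G t" if "t > 0" for t
    unfolding L_def using that by (intro cINF_lower bdd) auto
  have "(G \<longlongrightarrow> L) at_top"
  proof (rule order_tendstoI)
    fix a assume "a < L"
    show "eventually (\<lambda>t. a < G t) at_top"
      by (rule eventually_mono[OF eventually_gt_at_top[of 0]]) (use L \<open>a < L\<close> in force)
  next
    fix a assume "L < a"
    then obtain s where s: "s > 0" "G s < a"
      unfolding L_def using cINF_less_iff[OF _ bdd] by auto
    show "eventually (\<lambda>t. G t < a) at_top"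
      by (rule eventually_mono[OF eventually_ge_at_top[of s]]) (use s G_antimono in force)
  qed
  then have "G_infinity G = L" unfolding G_infinity_def by (intro tendsto_Lim) auto
  then show ?thesis using L[OF assms] by simp
qed

text \<open>Near 0 the exponential is at most 1 and local integrability suffices; beyond 1 it is
  \<open>G\<close> that is bounded, by \<open>G 1\<close>.\<close>

lemma G_exp_integrable:
  assumes "a > 0"
  shows "set_integrable lborel {0<..} (\<lambda>t. G t * exp (- a * t))"
proof -
  have cont: "set_borel_measurable lborel A (\<lambda>t. G t * exp (- a * t))"
    if "A \<subseteq> {0<..}" "A \<in> sets borel" for A
    unfolding set_borel_measurable_def using that
    by (simp only: measurable_lborel1 measurable_lborel2)
      (intro borel_measurable_continuous_on_indicator continuous_intros
        continuous_on_subset[OF continuous_on_G], auto)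
  have e: "(\<lambda>t. exp (- a * t)) \<in> borel_measurable borel" by measurable
  have "(\<lambda>t. exp (- a * t)) absolutely_integrable_on {1..}"
    using assms by (intro nonnegative_absolutely_integrable_1 integrable_on_exp_minus_to_infinity) auto
  \<comment> \<open>\<open>absolutely_integrable_on\<close> refers to \<open>lebesgue\<close>, the
    completion of \<open>lborel\<close>.\<close>
  then have ei: "set_integrable lborel {1..} (\<lambda>t. exp (- a * t))"
    unfolding set_integrable_def by (subst (asm) integrable_completion) (use e in auto)
  have "set_integrable lborel {0<..1} (\<lambda>t. G t * exp (- a * t))"
  proof (rule set_integrable_bound)
    show "set_integrable lborel {0<..1} G" using loc_int by (simp add: locally_integrable_def)
    have "norm (G t * exp (- a * t)) \<le> norm (G t)" if "t \<in> {0<..1}" for t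
      using that assms by (simp add: abs_mult mult_left_le)
    then show "AE t in lborel. t \<in> {0<..1} \<longrightarrow> norm (G t * exp (- a * t)) \<le> norm (G t)" by simp
  qed (rule cont, auto)
  moreover have "set_integrable lborel {1..} (\<lambda>t. G t * exp (- a * t))"
  proof (rule set_integrable_bound)
    show "set_integrable lborel {1..} (\<lambda>t. G 1 * exp (- a * t))" using ei by simp
    have "norm (G t * exp (- a * t)) \<le> norm (G 1 * exp (- a * t))" if "t \<in> {1..}" for t
      using that G_antimono[of 1 t] G_nonneg[of t] by (simp add: abs_mult mult_right_mono)
    then show "AE t in lborel. t \<in> {1..} \<longrightarrow> norm (G t * exp (- a * t)) \<le> norm (G 1 * exp (- a * t))"
      by simp
  qed (rule cont, auto)
  ultimately have "set_integrable lborel ({0<..1} \<union> {1..}) (\<lambda>t. G t * exp (- a * t))"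
    by (rule set_integrable_Un) auto
  moreover have "{0<..1} \<union> {1::real..} = {0<..}" by auto
  ultimately show ?thesis by (simp only:)
qed

lemma laplace_eq: "Re p > 0 \<Longrightarrow>
    laplace G p = (\<integral>t. indicator {0<..} t *\<^sub>R (of_real (G t) * exp (- p * of_real t)) \<partial>lborel)"
  by (simp add: laplace_def analytic_continuation_def set_lebesgue_integral_def)

lemma laplace_integrand_measurable:
  "(\<lambda>t. indicator {0<..} t *\<^sub>R (of_real (G t) * exp (- p * of_real t)) :: complex) \<in> borel_measurable lborel"
  by (simp only: measurable_lborel1 measurable_lborel2)
    (intro borel_measurable_continuous_on_indicator continuous_intros continuous_on_G, auto)

lemma norm_laplace_integrand_le:
  assumes "a \<le> Re p"
  shows "norm (indicator {0<..} t *\<^sub>R (of_real (G t) * exp (- p * of_real t)) :: complex)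
    \<le> indicator {0<..} t *\<^sub>R (G t * exp (- a * t))"
  using assms G_nonneg[of t]
  by (auto simp: indicator_def norm_mult intro!: mult_left_mono)

lemma Q_of_holomorphic: "Q_of G holomorphic_on right_half_plane"
proof -
  have "(\<lambda>p. \<integral>t. indicator {0<..} t *\<^sub>R (of_real (G t) * exp (- p * of_real t)) \<partial>lborel)
      holomorphic_on right_half_plane"
  proof (rule holomorphic_on_integral[OF open_right_half_plane])
    fix p assume p: "p \<in> right_half_plane"
    show "\<exists>r>0. \<exists>g. integrable lborel g \<and> (\<forall>w\<in>ball p r \<inter> right_half_plane. \<forall>t\<in>space lborel.
        norm (indicator {0<..} t *\<^sub>R (of_real (G t) * exp (- w * of_real t)) :: complex) \<le> g t)"
    proof (intro exI[of _ "Re p / 2"] exI[of _ "\<lambda>t. indicator {0<..} t *\<^sub>R (G t * exp (- (Re p / 2) * t))"]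
        conjI ballI norm_laplace_integrand_le)
      show "integrable lborel (\<lambda>t. indicator {0<..} t *\<^sub>R (G t * exp (- (Re p / 2) * t)))"
        using G_exp_integrable[of "Re p / 2"] p by (simp add: set_integrable_def)
      fix w assume w: "w \<in> ball p (Re p / 2) \<inter> right_half_plane"
      then show "Re p / 2 \<le> Re w" using complex_Re_le_cmod[of "p - w"] by (simp add: dist_norm)
    qed (use p in auto)
  qed (intro holomorphic_intros laplace_integrand_measurable)+
  then have "laplace G holomorphic_on right_half_plane"
    by (rule holomorphic_transform) (simp add: laplace_eq)
  then show ?thesis
    unfolding Q_of_def[abs_def] by (intro holomorphic_on_mult holomorphic_on_ident)
qed

text \<open>Since \<open>G\<close> decreases, d G(d) is at most the integral of \<open>G\<close>
  over (0, d], which tends to 0. This tames the singularity of \<open>G\<close> at 0 in the partial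
  integration.\<close>

lemma mult_G_tendsto_0: "(\<lambda>n. inverse (real (Suc n)) * G (inverse (real (Suc n)))) \<longlonglongrightarrow> 0"
proof -
  define d where "d = (\<lambda>n. inverse (real (Suc n)))"
  have d: "d n > 0" "d n \<le> 1" for n by (auto simp: d_def inverse_le_1_iff)
  have i1: "integrable lborel (\<lambda>t. indicator {0<..1} t *\<^sub>R G t)"
    using loc_int by (simp add: locally_integrable_def set_integrable_def)
  have int: "integrable lborel (\<lambda>t. indicator {0<..d n} t *\<^sub>R G t)" for n
  proof -
    have "{0<..d n} \<subseteq> {0<..1}" using d(2)[of n] by auto
    then have "set_integrable lborel {0<..d n} G"
      using loc_int unfolding locally_integrable_def by (rule set_integrable_subset[rotated 2]) auto
    then show ?thesis by (simp only: set_integrable_def)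
  qed
  have "(\<lambda>n. \<integral>t. indicator {0<..d n} t *\<^sub>R G t \<partial>lborel) \<longlonglongrightarrow> integral\<^sup>L lborel (\<lambda>t :: real. 0 :: real)"
  proof (rule integral_dominated_convergence)
    show "integrable lborel (\<lambda>t. indicator {0<..1} t *\<^sub>R G t)" by (rule i1)
    show "AE t in lborel. (\<lambda>n. indicator {0<..d n} t *\<^sub>R G t) \<longlonglongrightarrow> 0"
    proof (rule AE_I2)
      fix t :: real
      have d0: "d \<longlonglongrightarrow> 0" unfolding d_def by (rule LIMSEQ_inverse_real_of_nat)
      have "eventually (\<lambda>n. indicator {0<..d n} t *\<^sub>R G t = 0) sequentially" if "t > 0"
        by (rule eventually_mono[OF order_tendstoD(2)[OF d0 that]]) (simp add: indicator_def)
      then have "eventually (\<lambda>n. indicator {0<..d n} t *\<^sub>R G t = 0) sequentially"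
        by (cases "t > 0") (auto simp: indicator_def)
      then show "(\<lambda>n. indicator {0<..d n} t *\<^sub>R G t) \<longlonglongrightarrow> 0" by (rule tendsto_eventually)
    qed
    show "AE t in lborel. norm (indicator {0<..d n} t *\<^sub>R G t) \<le> indicator {0<..1} t *\<^sub>R G t" for n
      using d(2)[of n] G_nonneg by (intro AE_I2) (auto simp: indicator_def)
  qed (use int in \<open>auto simp: borel_measurable_integrable\<close>)
  then have lim: "(\<lambda>n. \<integral>t. indicator {0<..d n} t *\<^sub>R G t \<partial>lborel) \<longlonglongrightarrow> 0" by simp
  have le: "d n * G (d n) \<le> (\<integral>t. indicator {0<..d n} t *\<^sub>R G t \<partial>lborel)" for n
  proof -
    have "d n * G (d n) = (\<integral>t. indicator {0<..d n} t *\<^sub>R G (d n) \<partial>lborel)"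
      using d(1)[of n] by simp
    also have "\<dots> \<le> (\<integral>t. indicator {0<..d n} t *\<^sub>R G t \<partial>lborel)"
    proof (rule integral_mono[OF _ int])
      show "integrable lborel (\<lambda>t. indicator {0<..d n} t *\<^sub>R G (d n))"
        using d(1)[of n] by (intro integrable_scaleR_left integrable_real_indicator) auto
      show "indicator {0<..d n} t *\<^sub>R G (d n) \<le> indicator {0<..d n} t *\<^sub>R G t" for t
        using d(1)[of n] G_antimono[of t "d n"] by (auto simp: indicator_def)
    qed
    finally show ?thesis .
  qed
  have "(\<lambda>n. d n * G (d n)) \<longlonglongrightarrow> 0"
    by (rule tendsto_sandwich[OF _ _ tendsto_const lim])
      (use le d(1) G_nonneg in \<open>auto intro!: always_eventually mult_nonneg_nonneg simp: less_imp_le\<close>)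
  then show ?thesis by (simp add: d_def)
qed

text \<open>p exp(-pt) is the derivative of 1 - exp(-pt), so Re Q is the integral of
  \<open>G\<close> times the derivative \<open>e'\<close> of the real part \<open>e\<close>. Partial
  integration leaves boundary terms that tend to \<open>G_infinity G\<close> and 0, plus the
  integral of -G' e, which is nonnegative.\<close>

lemma Re_Q_of_ge:
  assumes p: "Re p > 0"
  shows "G_infinity G \<le> Re (Q_of G p)"
proof -
  define a b where "a = Re p" and "b = Im p"
  have a: "a > 0" using p by (simp add: a_def)
  define e where "e = (\<lambda>t. 1 - exp (- a * t) * cos (b * t))" \<comment> \<open>\<open>Re (1 - exp (- p t))\<close>\<close>
  define e' where "e' = (\<lambda>t. exp (- a * t) * (a * cos (b * t) + b * sin (b * t)))"
  have De: "(e has_real_derivative e' t) (at t)" for t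
    unfolding e_def e'_def by (auto intro!: derivative_eq_intros simp: algebra_simps)
  have e_nonneg: "e t \<ge> 1 - exp (- a * t)" for t
    unfolding e_def by (simp add: mult_left_le)
  define q where "q = (\<lambda>t. G t * e' t)"
  define f where "f = (\<lambda>t. indicator {0<..} t *\<^sub>R (of_real (G t) * exp (- p * of_real t)) :: complex)"
  have intf: "integrable lborel f"
  proof (rule Bochner_Integration.integrable_bound)
    show "integrable lborel (\<lambda>t. indicator {0<..} t *\<^sub>R (G t * exp (- a * t)))"
      using G_exp_integrable[OF a] by (simp add: set_integrable_def)
    show "AE t in lborel. norm (f t) \<le> norm (indicator {0<..} t *\<^sub>R (G t * exp (- a * t)))"
      unfolding f_def using norm_laplace_integrand_le[of a p]
      by (intro AE_I2) (auto simp: a_def intro: order_trans[OF _ abs_ge_self])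
  qed (unfold f_def, rule laplace_integrand_measurable)
  have Re_eq: "Re (p * f t) = indicator {0<..} t *\<^sub>R q t" for t
    by (simp add: f_def q_def e'_def a_def b_def Re_exp Im_exp algebra_simps)
  have intq: "integrable lborel (\<lambda>t. indicator {0<..} t *\<^sub>R q t)"
    unfolding Re_eq[symmetric] using intf by (intro integrable_Re) simp
  have Q: "Re (Q_of G p) = (\<integral>t. indicator {0<..} t *\<^sub>R q t \<partial>lborel)"
  proof -
    have "Q_of G p = p * (\<integral>t. f t \<partial>lborel)"
      unfolding Q_of_def laplace_eq[OF p] f_def ..
    also have "\<dots> = (\<integral>t. p * f t \<partial>lborel)" by simp
    finally show ?thesis
      unfolding Re_eq[symmetric] using integral_Re[OF integrable_mult_right[OF intf, of p]] by simp
  qed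
  \<comment> \<open>The intervals [d n, u n] exhaust the half-line while avoiding the possible
    singularity at 0.\<close>
  define d u where "d = (\<lambda>n. inverse (real (Suc n)))" and "u = (\<lambda>n. real (Suc n))"
  have du: "0 < d n" "d n \<le> u n" for n
    by (auto simp: d_def u_def intro: order_trans[of _ 1] simp: inverse_le_1_iff)
  have d0: "d \<longlonglongrightarrow> 0" unfolding d_def by (rule LIMSEQ_inverse_real_of_nat)
  have utop: "filterlim u at_top sequentially"
    unfolding u_def by (rule filterlim_compose[OF filterlim_real_sequentially filterlim_Suc])
  have ints: "set_integrable lborel {d n..u n} q" for n
    using set_integrable_subset[of lborel "{0<..}" q "{d n..u n}"] intq du(1)[of n]
    unfolding set_integrable_def by force
  have lim: "(\<lambda>n. \<integral>t. indicator {d n..u n} t *\<^sub>R q t \<partial>lborel) \<longlonglongrightarrow> Re (Q_of G p)"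
    unfolding Q
  proof (rule integral_dominated_convergence)
    show "integrable lborel (\<lambda>t. norm (indicator {0<..} t *\<^sub>R q t))" using intq by simp
    show "AE t in lborel. (\<lambda>n. indicator {d n..u n} t *\<^sub>R q t) \<longlonglongrightarrow> indicator {0<..} t *\<^sub>R q t"
    proof (rule AE_I2)
      fix t :: real
      have "eventually (\<lambda>n. indicator {d n..u n} t *\<^sub>R q t = indicator {0<..} t *\<^sub>R q t) sequentially"
      proof (cases "t > 0")
        case True
        show ?thesis
          using order_tendstoD(2)[OF d0 True] utop[unfolded filterlim_at_top, rule_format, of t]
          by eventually_elim (use True in \<open>auto simp: indicator_def\<close>)
      next
        case False
        then have "t \<notin> {d n..u n}" for n using du(1)[of n] by auto
        then show ?thesis using False by (simp add: indicator_def)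
      qed
      then show "(\<lambda>n. indicator {d n..u n} t *\<^sub>R q t) \<longlonglongrightarrow> indicator {0<..} t *\<^sub>R q t"
        by (rule tendsto_eventually)
    qed
    show "AE t in lborel. norm (indicator {d n..u n} t *\<^sub>R q t) \<le> norm (indicator {0<..} t *\<^sub>R q t)" for n
      using du(1)[of n] by (intro AE_I2) (auto simp: indicator_def)
  qed (use intq ints in \<open>auto simp: set_integrable_def borel_measurable_integrable\<close>)
  \<comment> \<open>The lower boundary term G(d) e(d) is written as d G(d) times e(d)/d: the first
    factor tends to 0, the second to e'(0).\<close>
  have ge: "G_infinity G * (1 - exp (- a * u n)) - d n * G (d n) * (e (d n) / d n)
      \<le> (\<integral>t. indicator {d n..u n} t *\<^sub>R q t \<partial>lborel)" for n
  proof -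
    have q: "(q has_integral (\<integral>t. indicator {d n..u n} t *\<^sub>R q t \<partial>lborel)) {d n..u n}"
      using integrable_integral[OF set_borel_integral_eq_integral(1)[OF ints, of n]]
      unfolding set_borel_integral_eq_integral(2)[OF ints, of n, symmetric] set_lebesgue_integral_def .
    \<comment> \<open>The fundamental theorem integrates the sum as a whole, and the sum is then
      compared with \<open>q\<close>; so the integrability of \<open>deriv G t * e t\<close> never
      has to be shown separately.\<close>
    have "((\<lambda>t. deriv G t * e t + q t) has_integral (G (u n) * e (u n) - G (d n) * e (d n))) {d n..u n}"
    proof (rule fundamental_theorem_of_calculus[OF du(2)])
      fix t assume "t \<in> {d n..u n}"
      then have "t > 0" using du(1)[of n] by auto
      then have "((\<lambda>t. G t * e t) has_real_derivative deriv G t * e t + q t) (at t)"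
        using DERIV_mult[OF G_has_deriv De[of t]] by (simp add: q_def mult.commute)
      then show "((\<lambda>t. G t * e t) has_vector_derivative deriv G t * e t + q t) (at t within {d n..u n})"
        unfolding has_real_derivative_iff_has_vector_derivative
        by (rule has_vector_derivative_at_within)
    qed
    then have "G (u n) * e (u n) - G (d n) * e (d n) \<le> (\<integral>t. indicator {d n..u n} t *\<^sub>R q t \<partial>lborel)"
    proof (rule has_integral_le[OF _ q])
      fix t assume "t \<in> {d n..u n}"
      then have "t > 0" using du(1)[of n] by auto
      moreover from this have "exp (- a * t) \<le> 1" using a by simp
      then have "e t \<ge> 0" using e_nonneg[of t] by linarith
      ultimately show "deriv G t * e t + q t \<le> q t"
        using deriv_G_nonpos[of t] by (simp add: mult_nonpos_nonneg)
    qed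
    moreover have "G_infinity G * (1 - exp (- a * u n)) \<le> G (u n) * e (u n)"
    proof -
      have "u n > 0" by (simp add: u_def)
      moreover from this have "exp (- a * u n) \<le> 1" using a by simp
      ultimately show ?thesis
        using G_infinity_le[of "u n"] e_nonneg[of "u n"] G_nonneg[of "u n"]
        by (intro mult_mono) auto
    qed
    ultimately show ?thesis using du(1)[of n] by simp
  qed
  have "(\<lambda>n. e (d n) / d n) \<longlonglongrightarrow> e' 0"
  proof -
    have "filterlim d (at 0) sequentially"
      using d0 du(1) by (simp add: filterlim_at order_less_imp_not_eq2)
    moreover have "((\<lambda>h. e h / h) \<longlongrightarrow> e' 0) (at 0)"
      using De[of 0] by (simp add: DERIV_def e_def)
    ultimately show ?thesis by (rule filterlim_compose[rotated])
  qed
  moreover have "(\<lambda>n. d n * G (d n)) \<longlonglongrightarrow> 0" using mult_G_tendsto_0 by (simp add: d_def)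
  moreover have "(\<lambda>n. exp (- a * u n)) \<longlonglongrightarrow> 0"
  proof -
    have "filterlim (\<lambda>n. - a * u n) at_bot sequentially"
      using a utop by (intro filterlim_tendsto_neg_mult_at_bot[OF tendsto_const]) auto
    then show ?thesis by (rule filterlim_compose[OF exp_at_bot])
  qed
  ultimately have lower: "(\<lambda>n. G_infinity G * (1 - exp (- a * u n)) - d n * G (d n) * (e (d n) / d n))
      \<longlonglongrightarrow> G_infinity G * (1 - 0) - 0 * e' 0"
    by (intro tendsto_intros)
  have "G_infinity G * (1 - 0) - 0 * e' 0 \<le> Re (Q_of G p)"
    by (rule LIMSEQ_le[OF lower lim]) (use ge in blast)
  then show ?thesis by simp
qed

end

section \<open>Minimum phase\<close>

text \<open>On an open set analytic means holomorphic, so a zero-free holomorphic formula for the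
  transform settles both the transform and its reciprocal.\<close>

lemma minimum_phaseI:
  assumes "tempered_distribution T" "causal T"
    and F: "F holomorphic_on upper_half_plane" "\<And>\<omega>. \<omega> \<in> upper_half_plane \<Longrightarrow> F \<omega> \<noteq> 0"
    and eq: "\<And>\<omega>. \<omega> \<in> upper_half_plane \<Longrightarrow> fourier T \<omega> = F \<omega>"
  shows "minimum_phase T"
proof -
  have op: "open upper_half_plane"
    unfolding upper_half_plane_def by (rule open_halfspace_Im_gt)
  have hol: "fourier T holomorphic_on upper_half_plane"
    using F(1) by (rule holomorphic_transform) (simp add: eq)
  moreover have "(\<lambda>\<omega>. 1 / fourier T \<omega>) holomorphic_on upper_half_plane"
    using hol eq F(2) by (intro holomorphic_on_divide holomorphic_on_const) auto
  ultimately show ?thesis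
    using assms unfolding minimum_phase_def analytic_on_open[OF op] by auto
qed

text \<open>Multiplication by -i is the quarter turn from the upper to the right half-plane, from
  the Fourier variable to the Laplace variable.\<close>

lemma holomorphic_on_rotate:
  assumes "f holomorphic_on right_half_plane"
  shows "(\<lambda>\<omega>. f (- \<i> * \<omega>)) holomorphic_on upper_half_plane"
proof -
  have "(f \<circ> (\<lambda>\<omega>. - \<i> * \<omega>)) holomorphic_on upper_half_plane"
    using assms by (rule holomorphic_on_compose_gen[rotated])
      (auto intro!: holomorphic_intros simp: upper_half_plane_def)
  then show ?thesis by (simp add: o_def)
qed

lemma minimum_phase_convolution:
  assumes S: "minimum_phase S" and T: "minimum_phase T"
  shows "minimum_phase (convolution S T)"
proof -
  have op: "open upper_half_plane"
    unfolding upper_half_plane_def by (rule open_halfspace_Im_gt)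
  have S': "tempered_distribution S" "causal S" "fourier S holomorphic_on upper_half_plane"
      "\<forall>\<omega>\<in>upper_half_plane. fourier S \<omega> \<noteq> 0"
    and T': "tempered_distribution T" "causal T" "fourier T holomorphic_on upper_half_plane"
      "\<forall>\<omega>\<in>upper_half_plane. fourier T \<omega> \<noteq> 0"
    using S T unfolding minimum_phase_def analytic_on_open[OF op] by blast+
  show ?thesis
  proof (rule minimum_phaseI)
    show "(\<lambda>\<omega>. fourier S \<omega> * fourier T \<omega>) holomorphic_on upper_half_plane"
      by (intro holomorphic_on_mult S' T')
    show "fourier S \<omega> * fourier T \<omega> \<noteq> 0" if "\<omega> \<in> upper_half_plane" for \<omega>
      using S'(4) T'(4) that by simp
    show "fourier (convolution S T) \<omega> = fourier S \<omega> * fourier T \<omega>"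
      if "\<omega> \<in> upper_half_plane" for \<omega>
      by (rule fourier_convolution) (use S' T' that in \<open>auto simp: upper_half_plane_def\<close>)
  qed (intro tempered_convolution causal_convolution S' T')+
qed

theorem mainTheorem4:
  fixes \<rho> x B :: real and G :: "real \<Rightarrow> real" and \<nu> :: "real measure"
    and M u1 :: functional
  assumes "\<rho> > 0" and "x > 0"
    and "completely_monotonic G" and "locally_integrable G" and "G_infinity G > 0"
    and "kappa_representation \<rho> G B \<nu>"
    and "tempered_distribution M" and "causal M"
    and "\<And>\<omega>. Im \<omega> > 0 \<Longrightarrow> fourier M \<omega> = exp (- beta \<nu> (- \<i> * \<omega>) * of_real x)"
    and "tempered_distribution u1" and "causal u1"
    and "\<And>\<omega>. Im \<omega> > 0 \<Longrightarrow>
       fourier u1 \<omega> = of_real \<rho> / (2 * Q_of G (- \<i> * \<omega>) * kappa \<rho> G (- \<i> * \<omega>))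
                       * exp (- kappa \<rho> G (- \<i> * \<omega>) * of_real x)"
  shows "minimum_phase M \<and> minimum_phase u1 \<and>
    (\<forall>s. minimum_phase s \<longrightarrow> minimum_phase (convolution s u1))"
proof -
  interpret relaxation_modulus G by standard (fact assms)+
  have ReQ: "Re (Q_of G p) > 0" if "p \<in> right_half_plane" for p
    using Re_Q_of_ge[of p] assms(5) that by simp
  have Q0: "Q_of G p \<noteq> 0" if "p \<in> right_half_plane" for p using ReQ[OF that] by auto
  have Qdom: "Q_of G p \<notin> \<real>\<^sub>\<le>\<^sub>0" if "p \<in> right_half_plane" for p
    using ReQ[OF that] by (auto simp: complex_nonpos_Reals_iff)
  have kappa: "kappa \<rho> G holomorphic_on right_half_plane"
    unfolding kappa_def[abs_def]
    by (intro holomorphic_intros Q_of_holomorphic Qdom) (use Q0 in auto)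
  have kappa0: "kappa \<rho> G p \<noteq> 0" if "p \<in> right_half_plane" for p
    using that Q0[OF that] assms(1) by (auto simp: kappa_def)
  have \<nu>: "sets \<nu> = sets (restrict_space borel {0<..})" "(\<integral>\<^sup>+r. ennreal (1 / (1 + r)) \<partial>\<nu>) < \<infinity>"
    using assms(6) by (auto simp: kappa_representation_def radon_measure_pos_def)
  have "minimum_phase M"
  proof (rule minimum_phaseI[OF assms(7,8)])
    show "(\<lambda>\<omega>. exp (- beta \<nu> (- \<i> * \<omega>) * of_real x)) holomorphic_on upper_half_plane"
      by (intro holomorphic_intros holomorphic_on_rotate beta_holomorphic \<nu>)
  qed (use assms(9) in \<open>auto simp: upper_half_plane_def\<close>)
  moreover have "minimum_phase u1"
  proof (rule minimum_phaseI[OF assms(10,11)])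
    have rot: "- \<i> * \<omega> \<in> right_half_plane" if "\<omega> \<in> upper_half_plane" for \<omega>
      using that by (simp add: upper_half_plane_def)
    show "(\<lambda>\<omega>. of_real \<rho> / (2 * Q_of G (- \<i> * \<omega>) * kappa \<rho> G (- \<i> * \<omega>))
        * exp (- kappa \<rho> G (- \<i> * \<omega>) * of_real x)) holomorphic_on upper_half_plane"
      using Q0[OF rot] kappa0[OF rot]
      by (intro holomorphic_intros holomorphic_on_rotate[OF kappa] holomorphic_on_rotate[OF Q_of_holomorphic])
        (simp only: mult_eq_0_iff, simp)
    show "of_real \<rho> / (2 * Q_of G (- \<i> * \<omega>) * kappa \<rho> G (- \<i> * \<omega>))
        * exp (- kappa \<rho> G (- \<i> * \<omega>) * of_real x) \<noteq> 0" if "\<omega> \<in> upper_half_plane" for \<omega>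
      using Q0[OF rot[OF that]] kappa0[OF rot[OF that]] assms(1) by simp
    show "fourier u1 \<omega> = of_real \<rho> / (2 * Q_of G (- \<i> * \<omega>) * kappa \<rho> G (- \<i> * \<omega>))
        * exp (- kappa \<rho> G (- \<i> * \<omega>) * of_real x)" if "\<omega> \<in> upper_half_plane" for \<omega>
      using that by (intro assms(12)) (simp add: upper_half_plane_def)
  qed
  ultimately show ?thesis using minimum_phase_convolution by blast
qed

end
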